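(* Let $P_1=(s_1,t_1)$ and $P_2=(s_2,t_2)$ be points of $\Omega=[0,\infty)\times[0,1)$ such that $P_2$ lies above the forward extremal curve for $P_1$, that is, $s_1<s_2$ and $t_2>t_1+(1-t_1)\left(1-\frac{s_1}{s_2}\right)\xi_0(s_1)$. Then: (a) the set $\mathrm{qsup}(\mathfrak{A}_{s_1}^{t_1},\mathfrak{A}_{s_2}^{t_2})$ consists exactly of the sets $\mathfrak{A}_s^{\tau_1(s)}$ with $s\ge s_2$, where $\tau_1(s)=\min\{t_{\uparrow,P_1}(s),\,t_{\uparrow,P_2}(s)\}$; (b) the set $\mathrm{qinf}(\mathfrak{A}_{s_1}^{t_1},\mathfrak{A}_{s_2}^{t_2})$ consists exactly of the sets $\mathfrak{A}_s^{\tau_2(s)}$ with $0<s\le s_1$ and $\tau_2(s)\ge 0$, where $\tau_2(s)=\max\{t_{\downarrow,P_1}(s),\,t_{\downarrow,P_2}(s)\}$.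
   Context: Let $\mathbb{D}=\{z\in\mathbb{C}:|z|<1\}$ and let $\mathcal{A}$ be the set of all holomorphic functions $f$ on $\mathbb{D}$ with $f(0)=0$ and $f'(0)=1$. For $s\in[0,\infty)$ and $t\in[0,1]$ define $$\mathfrak{A}_s^t:=\left\{f\in\mathcal{A}:\ \Re\left[(s-1)\frac{f(z)}{z}+f'(z)\right]\ge st\ \text{ for all } z\in\mathbb{D}\setminus\{0\}\right\},$$ and let $\mathfrak{A}:=\{\mathfrak{A}_s^t:\ s\in[0,\infty),\ t\in[0,1]\}$, partially ordered by inclusion. The function $\xi_0$ is defined for $s>0$ by $\xi_0(s)=\int_0^1\frac{1-x}{1+x}\,s\,x^{s-1}\,dx$, and $\xi_0(0)=1$ by continuity. For $P_0=(s_0,t_0)\in\Omega$ define, for $s\ge s_0$, $s>0$, $$t_{\uparrow,P_0}(s):=t_0+(1-t_0)\left(1-\frac{s_0}{s}\right)\xi_0(s_0),$$ whose graph is the forward extremal curve for $P_0$. For $s_0>0$ and $0<s\le s_0$ define $t_{\downarrow,P_0}(s)$ as the solution of $t_0=t_{\downarrow,P_0}(s)+(1-t_{\downarrow,P_0}(s))\left(1-\frac{s}{s_0}\right)\xi_0(s)$, i.e. $$t_{\downarrow,P_0}(s)=\frac{t_0-\left(1-\frac{s}{s_0}\right)\xi_0(s)}{1-\left(1-\frac{s}{s_0}\right)\xi_0(s)}$$ (this value may be negative). Quasi-extrema: for $\mathfrak{A}_1,\mathfrak{A}_2\in\mathfrak{A}$, - $\mathfrak{A}_0\in\mathfrak{A}$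 is a quasi-supremum of the pair, written $\mathfrak{A}_0\in\mathrm{qsup}(\mathfrak{A}_1,\mathfrak{A}_2)$, if $\mathfrak{A}_1\cup\mathfrak{A}_2\subset\mathfrak{A}_0$ and there is no $\mathfrak{A}_*\in\mathfrak{A}$ with $\mathfrak{A}_1\cup\mathfrak{A}_2\subset\mathfrak{A}_*\subsetneq\mathfrak{A}_0$; - $\mathfrak{A}_0\in\mathfrak{A}$ is a quasi-infimum of the pair, written $\mathfrak{A}_0\in\mathrm{qinf}(\mathfrak{A}_1,\mathfrak{A}_2)$, if $\mathfrak{A}_0\subset\mathfrak{A}_1\cap\mathfrak{A}_2$ and there is no $\mathfrak{A}_*\in\mathfrak{A}$ with $\mathfrak{A}_0\subsetneq\mathfrak{A}_*\subset\mathfrak{A}_1\cap\mathfrak{A}_2$. *)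

theory Defs
  imports "HOL-Complex_Analysis.Complex_Analysis"
begin

(* Functions on the unit disc are represented by total functions on complex, whose values off
   the disc are unconstrained.  Membership in the sets below depends only on the restriction to
   the disc, so inclusion and equality of these sets mean the same as for functions defined
   on the disc only. *)

definition classA :: "(complex \<Rightarrow> complex) set" where
  "classA = {f. f holomorphic_on ball 0 1 \<and> f 0 = 0 \<and> deriv f 0 = 1}"

(* Of interest only for s \<ge> 0 and 0 \<le> t \<le> 1; this restriction is imposed in frakA_family. *)
definition frakA :: "real \<Rightarrow> real \<Rightarrow> (complex \<Rightarrow> complex) set" where
  "frakA s t = {f \<in> classA. \<forall>z \<in> ball 0 1 - {0}.
      Re ((of_real s - 1) * (f z / z) + deriv f z) \<ge> s * t}"

definition frakA_family :: "(complex \<Rightarrow> complex) set set" where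
  "frakA_family = {frakA s t | s t. 0 \<le> s \<and> 0 \<le> t \<and> t \<le> 1}"

definition Omega :: "(real \<times> real) set" where
  "Omega = {0..} \<times> {0..<1}"

(* For 0 < s < 1 the integrand is unbounded but nonnegative near 0, so the integral over {0..1}
   is the (absolutely convergent) improper integral; the value at x = 0 is irrelevant. *)
definition xi0 :: "real \<Rightarrow> real" where
  "xi0 s = (if s = 0 then 1
            else integral {0..1} (\<lambda>x. (1 - x) / (1 + x) * s * x powr (s - 1)))"

(* Meaningful for s \<ge> s0, s > 0. *)
definition t_up :: "real \<times> real \<Rightarrow> real \<Rightarrow> real" where
  "t_up = (\<lambda>(s0, t0) s. t0 + (1 - t0) * (1 - s0 / s) * xi0 s0)"

(* The solution t of t0 = t + (1 - t) * (1 - s / s0) * xi0 s, that is of t_up (s, t) s0 = t0;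
   meaningful for 0 < s \<le> s0, and possibly negative. *)
definition t_down :: "real \<times> real \<Rightarrow> real \<Rightarrow> real" where
  "t_down = (\<lambda>(s0, t0) s.
      (t0 - (1 - s / s0) * xi0 s) / (1 - (1 - s / s0) * xi0 s))"

definition qsup ::
  "(complex \<Rightarrow> complex) set \<Rightarrow> (complex \<Rightarrow> complex) set \<Rightarrow> (complex \<Rightarrow> complex) set set" where
  "qsup A1 A2 = {A0 \<in> frakA_family. A1 \<union> A2 \<subseteq> A0 \<and>
      \<not> (\<exists>A \<in> frakA_family. A1 \<union> A2 \<subseteq> A \<and> A \<subset> A0)}"

definition qinf ::
  "(complex \<Rightarrow> complex) set \<Rightarrow> (complex \<Rightarrow> complex) set \<Rightarrow> (complex \<Rightarrow> complex) set set" where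
  "qinf A1 A2 = {A0 \<in> frakA_family. A0 \<subseteq> A1 \<inter> A2 \<and>
      \<not> (\<exists>A \<in> frakA_family. A0 \<subset> A \<and> A \<subseteq> A1 \<inter> A2)}"

end

theory Submission imports Defs begin

text \<open>
Writing \<open>g z = f z / z\<close>, the condition that defines \<open>frakA s t\<close> becomes \<open>Re (s * g z + z * deriv g z) \<ge> s * t\<close>. For
\<open>s > 0\<close> and \<open>t < 1\<close> the inclusion \<open>frakA s t \<subseteq> frakA s' t'\<close> holds exactly when \<open>s \<le> s'\<close> and \<open>t' \<le> t_up (s, t) s'\<close>
(\<open>frakA_nontrivial_subset_iff\<close>); that is, when \<open>(s', t')\<close> lies on or below the forward extremal curve. There are
three reasons.

\<^item> Harnack's inequality for \<open>s * g + z * deriv g\<close>, integrated along a radius, gives \<open>Re g \<ge> t + (1 - t) * xi0 s\<close>,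
  and the condition for \<open>s'\<close> differs from that for \<open>s\<close> by \<open>(s' - s) * Re g\<close> (\<open>frakA_subset_forward\<close>).
\<^item> The solution for the extremal function \<open>(1 + z) / (1 - z)\<close> of Harnack's inequality shows, near \<open>z = -1\<close>, that
  nothing better is true (\<open>frakA_subset_forward_iff\<close>).
\<^item> If \<open>s' < s\<close>, an explicit member of \<open>frakA s t\<close> with a logarithmic singularity at \<open>1\<close> violates every condition for \<open>s'\<close>
  (\<open>frakA_not_subset_backward\<close>).

The classes with \<open>s = 0\<close> or \<open>t = 1\<close> contain the identity of the disc only and are the least elements of the family.

What remains is plane geometry of the curves, with one analytic fact: forward curves are not consistent. Changing
at an intermediate point to the curve of that point leads strictly lower (\<open>t_up_two_steps_less\<close>). This amounts to
\<open>(1 / xi0 s - 1) / s\<close> being strictly increasing; its reciprocal is the mean of \<open>1 / (1 + x)\<close> on the unit interval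
with respect to the density \<open>x powr s / (1 + x)\<close>, and larger \<open>s\<close> moves the mass towards \<open>1\<close>
(\<open>mean_strictly_decreasing\<close>).

The upper bounds of the pair are the classes whose point has \<open>s \<ge> s2\<close> and lies on or below both forward curves.
Below the graph of the minimum \<open>\<tau>1\<close> a class can be shrunk by raising \<open>t\<close>; on the graph it is minimal, because by
the strictness above no point of the graph is on or below the forward curve of another. The lower bounds are
treated in the same way with backward curves and their maximum \<open>\<tau>2\<close>, with one addition: where \<open>\<tau>2\<close> is negative,
the constraint \<open>t \<ge> 0\<close> is the active one, and then \<open>s\<close> can be increased.
\<close>

section \<open>The function xi0\<close>

text \<open>On the unit interval consider the measure with density \<open>x powr s / (1 + x)\<close>; below are its total mass and the
integral of \<open>1 / (1 + x)\<close> against it, so that \<open>moment s / mass s\<close> is a mean value of \<open>1 / (1 + x)\<close>. Both \<open>xi0 s\<close>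
and \<open>1 - xi0 s\<close> are multiples of these integrals, which, unlike the integral defining \<^const>\<open>xi0\<close>, have
continuous integrands for every \<open>s > 0\<close>.\<close>

definition mass :: "real \<Rightarrow> real" where "mass s = integral {0..1} (\<lambda>x. x powr s / (1 + x))"
definition moment :: "real \<Rightarrow> real" where "moment s = integral {0..1} (\<lambda>x. x powr s / (1 + x)^2)"

text \<open>The default continuity rule for \<^term>\<open>(powr)\<close> wants a base that never vanishes; here the base is \<open>0\<close> at the left end.\<close>

lemma continuous_on_powr_unit:
  assumes "s > 0" shows "continuous_on {0..1::real} (\<lambda>x. x powr s)"
  using assms by (intro continuous_on_powr' continuous_intros) auto

lemma mass_has_integral:
  assumes "s > 0" shows "((\<lambda>x. x powr s / (1 + x)) has_integral mass s) {0..1}"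
  unfolding mass_def
  by (rule integrable_integral, rule integrable_continuous_real)
     (use assms in \<open>auto intro!: continuous_on_powr_unit continuous_intros\<close>)

lemma moment_has_integral:
  assumes "s > 0" shows "((\<lambda>x. x powr s / (1 + x)^2) has_integral moment s) {0..1}"
  unfolding moment_def
  by (rule integrable_integral, rule integrable_continuous_real)
     (use assms in \<open>auto intro!: continuous_on_powr_unit continuous_intros simp: add_eq_0_iff\<close>)

lemma integral_pos_continuous:
  fixes f :: "real \<Rightarrow> real"
  assumes "continuous_on {0..1} f" "\<And>x. x \<in> {0..1} \<Longrightarrow> f x \<ge> 0" "c \<in> {0..1}" "f c > 0"
  shows "integral {0..1} f > 0"
proof -
  have "integral {0..1} f \<noteq> 0"
    using integral_cbox_eq_0_iff[of 0 1 f] assms by fastforce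
  moreover have "integral {0..1} f \<ge> 0"
    using assms by (intro integral_nonneg integrable_continuous_real) auto
  ultimately show ?thesis by simp
qed

lemma mass_pos: assumes "s > 0" shows "mass s > 0"
  unfolding mass_def
  by (rule integral_pos_continuous[where c = 1])
     (use assms in \<open>auto intro!: continuous_on_powr_unit continuous_intros\<close>)

lemma moment_pos: assumes "s > 0" shows "moment s > 0"
  unfolding moment_def
  by (rule integral_pos_continuous[where c = 1])
     (use assms in \<open>auto intro!: continuous_on_powr_unit continuous_intros simp: add_eq_0_iff\<close>)

lemma mass_antimono: assumes "0 < a" "a \<le> b" shows "mass b \<le> mass a"
  using assms
  by (intro has_integral_le[OF mass_has_integral mass_has_integral])
     (auto intro!: divide_right_mono powr_mono')

text \<open>Passing from \<open>a\<close> to \<open>b\<close> multiplies the density by the increasing function \<open>x powr (b - a)\<close> and so moves mass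
towards \<open>1\<close>; hence the mean of the decreasing function \<open>1 / (1 + x)\<close> drops. This is Chebyshev's argument:
if \<open>m\<close> is the mean for \<open>a\<close>, attained by \<open>1 / (1 + x)\<close> at \<open>x = c\<close>, then \<open>m - 1 / (1 + x)\<close> and
\<open>x powr (b - a) - c powr (b - a)\<close> have the same sign, and the constant \<open>c powr (b - a)\<close> contributes nothing to
the integral of their product against the density for \<open>a\<close>.\<close>

lemma mean_strictly_decreasing:
  assumes "0 < a" "a < b"
  shows "moment b * mass a < moment a * mass b"
proof -
  define m where "m = moment a / mass a"
  define c where "c = 1 / m - 1"
  have m: "m > 0" using moment_pos mass_pos assms by (simp add: m_def)
  have "moment a \<le> mass a"
    using assms
    by (intro has_integral_le[OF moment_has_integral mass_has_integral])
       (auto intro!: divide_left_mono mult_pos_pos simp: power2_eq_square)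
  then have "m \<le> 1" using mass_pos[of a] assms by (simp add: m_def)
  then have c: "c \<ge> 0" using m by (simp add: c_def)
  have mc: "m = 1 / (1 + c)" using m by (simp add: c_def)
  define f where "f x = (x powr (b-a) - c powr (b-a)) * (m - 1/(1+x)) * (x powr a / (1+x))" for x
  have f0: "f x \<ge> 0" if "x \<in> {0..1}" for x
  proof -
    have "(x powr (b-a) - c powr (b-a)) * (m - 1/(1+x)) \<ge> 0"
    proof (cases "x \<le> c")
      case True
      then show ?thesis using that assms c mc
        by (intro mult_nonpos_nonpos) (auto intro!: powr_mono2 divide_left_mono mult_pos_pos)
    next
      case False
      then show ?thesis using that assms c mc
        by (intro mult_nonneg_nonneg) (auto intro!: powr_mono2 divide_left_mono mult_pos_pos)
    qed
    then show ?thesis using that by (auto simp: f_def)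
  qed
  have fcont: "continuous_on {0..1} f"
    unfolding f_def using assms by (auto intro!: continuous_on_powr_unit continuous_intros)
  have "\<exists>x\<in>{0..1}. f x > 0"
  proof -
    \<comment> \<open>Any positive point other than \<open>c\<close> makes the product of the two differences nonzero.\<close>
    define x where "x = (if c = 1 then 1/2 else 1::real)"
    have x: "x \<in> {0..1}" "x > 0" "x \<noteq> c" by (auto simp: x_def)
    have "x powr (b-a) \<noteq> c powr (b-a)"
      using x c assms by (smt (verit) atLeastAtMost_iff powr_less_mono2)
    moreover have "m \<noteq> 1/(1+x)" using x c mc by auto
    ultimately have "f x \<noteq> 0" using x by (auto simp: f_def)
    then show ?thesis using f0[OF x(1)] x by (intro bexI[of _ x]) auto
  qed
  then have pos: "integral {0..1} f > 0"
    using integral_pos_continuous[OF fcont f0] by auto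
  have feq: "f x = m * (x powr b / (1+x)) - x powr b / (1+x)^2
       - c powr (b-a) * (m * (x powr a / (1+x)) - x powr a / (1+x)^2)" if "x \<in> {0..1}" for x
  proof -
    have "x powr b = x powr (b-a) * x powr a" by (simp flip: powr_add)
    then show ?thesis by (simp add: f_def algebra_simps power2_eq_square)
  qed
  have int: "((\<lambda>x. m * (x powr b / (1+x)) - x powr b / (1+x)^2
       - c powr (b-a) * (m * (x powr a / (1+x)) - x powr a / (1+x)^2)) has_integral
       m * mass b - moment b - c powr (b-a) * (m * mass a - moment a)) {0..1}"
    using assms by (intro has_integral_diff has_integral_mult_right mass_has_integral moment_has_integral) auto
  from int have "(f has_integral (m * mass b - moment b - c powr (b-a) * (m * mass a - moment a))) {0..1}"
    by (rule has_integral_eq[rotated]) (rule feq[symmetric])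
  moreover have "m * mass a = moment a" using mass_pos[of a] assms by (simp add: m_def)
  ultimately have "integral {0..1} f = m * mass b - moment b" by (simp add: integral_unique)
  then have "moment b < m * mass b" using pos by simp
  then show ?thesis using mass_pos[of a] assms by (simp add: m_def field_simps)
qed

lemma powr_pred_mult: "x \<ge> 0 \<Longrightarrow> x powr (s - 1) * x = (x::real) powr s"
  by (cases "x = 0") (auto simp: powr_diff)

lemma has_integral_powr_pred:
  assumes "s > 0" shows "((\<lambda>x. s * x powr (s - 1)) has_integral 1) {0..1::real}"
proof -
  have "((\<lambda>x. s * x powr (s - 1)) has_integral (1 powr s - 0 powr s)) {0..1::real}"
    by (rule fundamental_theorem_of_calculus_interior)
       (use assms in \<open>auto intro!: continuous_on_powr_unit continuous_intros derivative_eq_intros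
          simp flip: has_real_derivative_iff_has_vector_derivative\<close>)
  then show ?thesis by simp
qed

text \<open>Integration by parts: this integrand and twice that of \<^const>\<open>moment\<close> differ by the derivative of
\<open>x powr s * (1 - x) / (1 + x)\<close>, which vanishes at both ends of the interval.\<close>

lemma xi0_has_integral_moment:
  assumes "s > 0"
  shows "((\<lambda>x. (1 - x) / (1 + x) * s * x powr (s - 1)) has_integral 2 * moment s) {0..1}"
proof -
  have "((\<lambda>x. (1 - x) / (1 + x) * s * x powr (s - 1) - 2 * (x powr s / (1 + x)^2)) has_integral
      (1 powr s * ((1 - 1) / (1 + 1)) - 0 powr s * ((1 - 0) / (1 + 0)))) {0..1::real}"
  proof (rule fundamental_theorem_of_calculus_interior)
    show "continuous_on {0..1} (\<lambda>x::real. x powr s * ((1 - x) / (1 + x)))"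
      using assms by (auto intro!: continuous_on_powr_unit continuous_intros)
    fix x :: real assume x: "x \<in> {0<..<1}"
    have "((\<lambda>x. x powr s * ((1 - x) / (1 + x))) has_real_derivative
      ((1 - x) / (1 + x) * s * x powr (s - 1) - 2 * (x powr s / (1 + x)^2))) (at x)"
      using x by (auto intro!: derivative_eq_intros simp: power2_eq_square divide_simps add_eq_0_iff)
        (auto simp: algebra_simps)
    then show "((\<lambda>x. x powr s * ((1 - x) / (1 + x))) has_vector_derivative
      ((1 - x) / (1 + x) * s * x powr (s - 1) - 2 * (x powr s / (1 + x)^2))) (at x)"
      by (simp add: has_real_derivative_iff_has_vector_derivative)
  qed simp
  from has_integral_add[OF this has_integral_mult_right[OF moment_has_integral[OF assms], of 2]]
  show ?thesis by simp
qed

lemma xi0_eq_moment: "s > 0 \<Longrightarrow> xi0 s = 2 * moment s"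
  using integral_unique[OF xi0_has_integral_moment] by (simp add: xi0_def)

lemma xi0_has_integral:
  assumes "s > 0"
  shows "((\<lambda>x. s * x powr (s - 1) * ((1 - x) / (1 + x))) has_integral xi0 s) {0..1}"
  using xi0_has_integral_moment[OF assms] by (simp add: xi0_eq_moment[OF assms] mult_ac)

lemma one_minus_xi0:
  assumes "s > 0" shows "1 - xi0 s = 2 * s * mass s"
proof -
  have int: "((\<lambda>x. s * x powr (s - 1) - s * x powr (s - 1) * ((1 - x) / (1 + x))) has_integral
      (1 - xi0 s)) {0..1}"
    by (intro has_integral_diff has_integral_powr_pred xi0_has_integral assms)
  moreover have "((\<lambda>x. 2 * s * (x powr s / (1 + x))) has_integral 2 * s * mass s) {0..1}"
    by (intro has_integral_mult_right mass_has_integral assms)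
  moreover have "s * x powr (s - 1) - s * x powr (s - 1) * ((1 - x) / (1 + x))
     = 2 * s * (x powr s / (1 + x))" if "x \<in> {0..1}" for x
  proof -
    have "s * x powr (s - 1) - s * x powr (s - 1) * ((1 - x) / (1 + x))
       = 2 * s * ((x powr (s - 1) * x) / (1 + x))"
      using that by (simp add: field_simps)
    then show ?thesis using that powr_pred_mult[of x s] by simp
  qed
  ultimately have "((\<lambda>x. s * x powr (s - 1) - s * x powr (s - 1) * ((1 - x) / (1 + x))) has_integral
      2 * s * mass s) {0..1}"
    using has_integral_cong[of "{0..1}"
      "\<lambda>x. s * x powr (s - 1) - s * x powr (s - 1) * ((1 - x) / (1 + x))"
      "\<lambda>x. 2 * s * (x powr s / (1 + x))"] by simp
  with int show ?thesis by (rule has_integral_unique)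
qed

lemma xi0_pos: "s > 0 \<Longrightarrow> xi0 s > 0" using xi0_eq_moment moment_pos by simp
lemma xi0_less_1: "s > 0 \<Longrightarrow> xi0 s < 1" using one_minus_xi0[of s] mass_pos[of s]
  by (smt (verit) mult_pos_pos)

text \<open>Since \<open>1 - xi0 s = 2 * s * mass s\<close> and \<open>xi0 s = 2 * moment s\<close>, the function \<open>(1 / xi0 s - 1) / s\<close> equals
\<open>mass s / moment s\<close>, hence is strictly increasing; this is that monotonicity with denominators cleared.\<close>

lemma inverse_xi0_excess_strict:
  assumes "0 < a" "a < b"
  shows "xi0 b * (b - (b - a) * xi0 a) < a * xi0 a"
proof -
  have "(4 * a * b) * (moment b * mass a) < (4 * a * b) * (moment a * mass b)"
    using mean_strictly_decreasing[OF assms] assms by simp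
  moreover have "xi0 b * (1 - xi0 a) * b = (4 * a * b) * (moment b * mass a)"
    unfolding one_minus_xi0[OF assms(1)] using xi0_eq_moment[of b] assms by simp
  moreover have "xi0 a * (1 - xi0 b) * a = (4 * a * b) * (moment a * mass b)"
    using one_minus_xi0[of b] xi0_eq_moment[of a] assms by simp
  ultimately have "xi0 b * (1 - xi0 a) * b < xi0 a * (1 - xi0 b) * a" by argo
  then show ?thesis by (simp add: algebra_simps)
qed

text \<open>As \<^const>\<open>mass\<close> is decreasing, \<open>(1 - xi0 s) / s\<close> is too. So \<^const>\<open>xi0\<close> cannot jump down to the right of
\<open>a\<close>, which is what allows a lower bound with \<open>t = 0\<close> to be enlarged by increasing \<open>s\<close>.\<close>

lemma xi0_lower_right:
  assumes "0 < a" "a \<le> b"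
  shows "1 - b / a * (1 - xi0 a) \<le> xi0 b"
proof -
  have "1 - xi0 b = 2 * b * mass b" using one_minus_xi0[of b] assms by simp
  also have "\<dots> \<le> 2 * b * mass a" using mass_antimono[OF assms] assms by simp
  also have "\<dots> = b / a * (2 * a * mass a)" using assms by simp
  also have "\<dots> = b / a * (1 - xi0 a)" using one_minus_xi0[of a] assms by simp
  finally show ?thesis by simp
qed

section \<open>Extremal curves\<close>

text \<open>The fraction of the distance from \<open>t\<close> to \<open>1\<close> that the forward extremal curve of \<open>(a, t)\<close> has covered at \<open>b\<close>.\<close>

definition gain :: "real \<Rightarrow> real \<Rightarrow> real" where "gain a b = (1 - a / b) * xi0 a"

lemma t_up_gain: "t_up (a, t) b = t + (1 - t) * gain a b"
  by (simp add: t_up_def gain_def)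

lemma gain_range: assumes "0 < a" "a \<le> b" shows "0 \<le> gain a b" "gain a b < 1"
proof -
  have "0 \<le> 1 - a/b" "1 - a/b \<le> 1" using assms by auto
  then show "0 \<le> gain a b" "gain a b < 1" unfolding gain_def
    using xi0_pos[of a] xi0_less_1[of a] assms
    by (auto intro: mult_nonneg_nonneg le_less_trans[OF mult_left_le_one_le])
qed

lemma t_up_self: "0 < a \<Longrightarrow> t_up (a, t) a = t" by (simp add: t_up_def)

lemma t_up_mono: assumes "0 < a" "a \<le> b" shows "t_up (a, t) b \<le> t_up (a, t') b \<longleftrightarrow> t \<le> t'"
proof -
  have "t_up (a, t') b - t_up (a, t) b = (t' - t) * (1 - gain a b)"
    by (simp add: t_up_gain algebra_simps)
  moreover have "1 - gain a b > 0" using gain_range[OF assms] by simp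
  ultimately show ?thesis by (smt (verit) zero_le_mult_iff)
qed

lemma t_up_ge: assumes "0 < a" "a \<le> b" "t \<le> 1" shows "t \<le> t_up (a, t) b"
  using gain_range[OF assms(1,2)] assms by (simp add: t_up_gain)

lemma t_up_less_1: assumes "0 < a" "a \<le> b" "t < 1" shows "t_up (a, t) b < 1"
proof -
  have "1 - t_up (a, t) b = (1 - t) * (1 - gain a b)" by (simp add: t_up_gain algebra_simps)
  then show ?thesis using gain_range[OF assms(1,2)] assms(3) by (smt (verit) mult_pos_pos)
qed

text \<open>After division by \<open>(1 - t) * (1 - b / c)\<close> the claim no longer mentions \<open>t\<close> and \<open>c\<close>, and it reduces to the strict
monotonicity of \<open>(1 / xi0 s - 1) / s\<close>. This strictness is the reason why quasi-extrema are not unique.\<close>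

lemma t_up_two_steps_less:
  assumes "0 < a" "a < b" "b < c" "t < 1"
  shows "t_up (b, t_up (a, t) b) c < t_up (a, t) c"
proof -
  have "gain a c - gain a b = (1 - b/c) * (a / b * xi0 a)" using assms by (simp add: gain_def field_simps)
  moreover have "xi0 b * (1 - gain a b) < a / b * xi0 a"
  proof -
    have "xi0 b * (1 - gain a b) = xi0 b * (b - (b - a) * xi0 a) / b"
      using assms by (simp add: gain_def field_simps)
    also have "\<dots> < a * xi0 a / b"
      using inverse_xi0_excess_strict[OF assms(1,2)] assms by (intro divide_strict_right_mono) auto
    finally show ?thesis by simp
  qed
  then have "(1 - b/c) * (xi0 b * (1 - gain a b)) < (1 - b/c) * (a / b * xi0 a)"
    using assms by (intro mult_strict_left_mono) auto
  moreover have "gain b c * (1 - gain a b) = (1 - b/c) * (xi0 b * (1 - gain a b))"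
    by (simp add: gain_def[of b c])
  ultimately have "gain b c * (1 - gain a b) < gain a c - gain a b" by linarith
  then have "(1 - t) * (gain b c * (1 - gain a b)) < (1 - t) * (gain a c - gain a b)"
    using assms by simp
  then show ?thesis by (simp add: t_up_gain algebra_simps)
qed

lemma t_down_gain: "t_down (b, t) a = (t - gain a b) / (1 - gain a b)"
  by (simp add: t_down_def gain_def)

lemma t_down_le_iff:
  assumes "0 < a" "a \<le> b" shows "t_down (b, t0) a \<le> t \<longleftrightarrow> t0 \<le> t_up (a, t) b"
proof -
  have "t_down (b, t0) a \<le> t \<longleftrightarrow> t0 - gain a b \<le> t * (1 - gain a b)"
    using gain_range[OF assms] by (simp add: t_down_gain pos_divide_le_eq)
  then show ?thesis by (auto simp: t_up_gain algebra_simps)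
qed

lemma t_up_t_down:
  assumes "0 < a" "a \<le> b" shows "t_up (a, t_down (b, t0) a) b = t0"
proof -
  have "t_down (b, t0) a * (1 - gain a b) = t0 - gain a b"
    using gain_range[OF assms] by (simp add: t_down_gain)
  then show ?thesis by (simp add: t_up_gain algebra_simps)
qed

lemma t_down_less_1: assumes "0 < a" "a \<le> b" "t0 < 1" shows "t_down (b, t0) a < 1"
  using gain_range[OF assms(1,2)] assms(3) by (simp add: t_down_gain pos_divide_less_eq)

lemma t_down_self: "0 < a \<Longrightarrow> t_down (a, t) a = t" by (simp add: t_down_def)

text \<open>The lower bound for \<^const>\<open>xi0\<close> to the right of \<open>a\<close> gives a continuous minorant \<open>l\<close> of the height at \<open>b\<close> of the curve
issuing from \<open>(x, t)\<close>, exact at \<open>x = a\<close>.\<close>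

lemma t_up_right_lower:
  assumes "0 < a" "a < b" "t0 < t_up (a, t) b" "t < 1"
  shows "eventually (\<lambda>x. t0 < t_up (x, t) b) (at_right a)"
proof -
  define l where "l x = t + (1 - t) * ((1 - x / b) * (1 - x / a * (1 - xi0 a)))" for x
  have "isCont l a"
    unfolding l_def using assms by (intro continuous_intros) auto
  then have "(l \<longlongrightarrow> l a) (at_right a)"
    using continuous_at_imp_continuous_at_within continuous_within by blast
  moreover have "l a = t_up (a, t) b" using assms by (simp add: l_def t_up_def)
  ultimately have "eventually (\<lambda>x. t0 < l x) (at_right a)"
    using assms(3) order_tendstoD(1) by metis
  moreover have "eventually (\<lambda>x. x \<in> {a<..<b}) (at_right a)"
    by (rule eventually_at_right_real[OF assms(2)])
  ultimately show ?thesis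
  proof eventually_elim
    case (elim x)
    have "l x \<le> t_up (x, t) b"
      using elim assms xi0_lower_right[of a x]
      by (auto simp: l_def t_up_def mult.assoc intro!: mult_left_mono)
    then show ?case using elim by simp
  qed
qed

section \<open>The classes in terms of f(z)/z\<close>

lemma deriv_quotient:
  assumes g: "g holomorphic_on ball 0 1" and f: "\<And>z. z \<in> ball 0 1 \<Longrightarrow> f z = z * g z"
    and z: "z \<in> ball 0 1"
  shows "deriv f z = g z + z * deriv g z"
proof -
  have "(g has_field_derivative deriv g z) (at z)"
    using g z by (simp add: holomorphic_derivI)
  then have "((\<lambda>z. z * g z) has_field_derivative (g z + z * deriv g z)) (at z)"
    by (auto intro!: derivative_eq_intros)
  then have "(f has_field_derivative (g z + z * deriv g z)) (at z)"
    by (rule has_field_derivative_transform_within_open[OF _ open_ball z]) (use f in auto)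
  then show ?thesis by (rule DERIV_imp_deriv)
qed

text \<open>For \<open>f\<close> in \<^const>\<open>classA\<close> these are the functions \<open>g z = f z / z\<close>, extended over \<open>0\<close>.\<close>

definition quotients :: "(complex \<Rightarrow> complex) set" where
  "quotients = {g. g holomorphic_on ball 0 1 \<and> g 0 = 1}"

text \<open>In terms of \<open>g z = f z / z\<close>, the quantity \<open>(s - 1) * f z / z + deriv f z\<close> is \<open>s * g z + z * deriv g z\<close>.\<close>

definition euler_re :: "real \<Rightarrow> (complex \<Rightarrow> complex) \<Rightarrow> complex \<Rightarrow> real" where
  "euler_re s g z = Re (of_real s * g z + z * deriv g z)"

lemma classA_quotient:
  assumes "f \<in> classA"
  shows "\<exists>g\<in>quotients. \<forall>s t. f \<in> frakA s t \<longleftrightarrow> (\<forall>z\<in>ball 0 1 - {0}. s * t \<le> euler_re s g z)"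
proof -
  obtain g where g: "g holomorphic_on ball 0 1" "\<And>z. norm z < 1 \<Longrightarrow> f z = z * g z" "deriv f 0 = g 0"
    using assms Schwarz3[of f 1] unfolding classA_def by blast
  have "(of_real s - 1) * (f z / z) + deriv f z = of_real s * g z + z * deriv g z"
    if "z \<in> ball 0 1 - {0}" for s z
    using that g(2)[of z] deriv_quotient[OF g(1), of f z] g(2) by (simp add: algebra_simps)
  then have "f \<in> frakA s t \<longleftrightarrow> (\<forall>z\<in>ball 0 1 - {0}. s * t \<le> euler_re s g z)" for s t
    unfolding frakA_def euler_re_def using assms by (simp del: plus_complex.sel times_complex.sel)
  moreover have "g \<in> quotients" using g assms by (auto simp: quotients_def classA_def)
  ultimately show ?thesis by blast
qed

lemma times_mem_frakA_iff:
  assumes "g \<in> quotients"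
  shows "(\<lambda>z. z * g z) \<in> frakA s t \<longleftrightarrow> (\<forall>z\<in>ball 0 1 - {0}. s * t \<le> euler_re s g z)"
proof -
  have g: "g holomorphic_on ball 0 1" using assms by (simp add: quotients_def)
  have d: "deriv (\<lambda>z. z * g z) z = g z + z * deriv g z" if "z \<in> ball 0 1" for z
    using deriv_quotient[OF g _ that] by simp
  have "(\<lambda>z. z * g z) \<in> classA"
    using g assms d[of 0] by (auto simp: classA_def quotients_def intro!: holomorphic_intros)
  moreover have "(of_real s - 1) * (z * g z / z) + deriv (\<lambda>z. z * g z) z = of_real s * g z + z * deriv g z"
    if "z \<in> ball 0 1 - {0}" for z
    using that d[of z] by (simp add: algebra_simps)
  ultimately show ?thesis
    unfolding frakA_def euler_re_def by (simp del: plus_complex.sel times_complex.sel)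
qed

text \<open>Functions in \<^const>\<open>classA\<close> that agree on the disc have the same quotient, so inclusions of the classes can be
decided on quotients, irrespective of the values off the disc.\<close>

lemma frakA_subset_iff:
  "frakA s t \<subseteq> frakA s' t' \<longleftrightarrow>
    (\<forall>g\<in>quotients. (\<forall>z\<in>ball 0 1 - {0}. s * t \<le> euler_re s g z) \<longrightarrow>
       (\<forall>z\<in>ball 0 1 - {0}. s' * t' \<le> euler_re s' g z))"
proof
  assume "frakA s t \<subseteq> frakA s' t'"
  then show "\<forall>g\<in>quotients. (\<forall>z\<in>ball 0 1 - {0}. s * t \<le> euler_re s g z) \<longrightarrow>
       (\<forall>z\<in>ball 0 1 - {0}. s' * t' \<le> euler_re s' g z)"
    using times_mem_frakA_iff by blast
next
  assume *: "\<forall>g\<in>quotients. (\<forall>z\<in>ball 0 1 - {0}. s * t \<le> euler_re s g z) \<longrightarrow>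
       (\<forall>z\<in>ball 0 1 - {0}. s' * t' \<le> euler_re s' g z)"
  show "frakA s t \<subseteq> frakA s' t'"
  proof
    fix f assume f: "f \<in> frakA s t"
    then have "f \<in> classA" by (simp add: frakA_def)
    then have "\<exists>g\<in>quotients. \<forall>s t. f \<in> frakA s t \<longleftrightarrow> (\<forall>z\<in>ball 0 1 - {0}. s * t \<le> euler_re s g z)"
      by (rule classA_quotient)
    with * f show "f \<in> frakA s' t'" by blast
  qed
qed

section \<open>Forward inclusions\<close>

text \<open>The Cayley transform \<open>(p - 1) / (p + 1)\<close> vanishes at \<open>0\<close> and maps the disc to itself, so the Schwarz lemma bounds it by
\<open>norm z\<close>. As \<open>p\<close> may take values with real part \<open>0\<close>, the argument is applied to \<open>(p + e) / (1 + e)\<close>,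
whose Cayley transform is the function \<open>w\<close> below.\<close>

lemma Harnack_lower:
  assumes p: "p holomorphic_on ball 0 1" and p0: "p 0 = 1"
    and pos: "\<And>z. z \<in> ball 0 1 \<Longrightarrow> 0 \<le> Re (p z)" and z: "z \<in> ball 0 1"
  shows "(1 - norm z) / (1 + norm z) \<le> Re (p z)"
proof (rule field_le_epsilon)
  fix e :: real assume e: "e > 0"
  define w where "w z = (p z - 1) / (p z + 1 + 2 * of_real e)" for z
  have den: "p x + 1 + 2 * of_real e \<noteq> 0" if "x \<in> ball 0 1" for x
  proof -
    have "Re (p x + 1 + 2 * of_real e) > 0" using pos[OF that] e by simp
    then show ?thesis by (metis less_irrefl zero_complex.sel(1))
  qed
  have "w holomorphic_on ball 0 1"
    unfolding w_def using den by (intro holomorphic_intros p) auto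
  moreover have "w 0 = 0" by (simp add: w_def p0)
  moreover have "norm (w x) < 1" if "norm x < 1" for x
  proof -
    have "(norm (p x - 1))^2 < (norm (p x + 1 + 2 * of_real e))^2"
    proof -
      have "(norm (p x + 1 + 2 * of_real e))^2 - (norm (p x - 1))^2
        = 4 * (1 + e) * (Re (p x) + e)"
        unfolding cmod_power2 by (simp add: power2_eq_square algebra_simps)
      moreover have "4 * (1 + e) * (Re (p x) + e) > 0"
        using pos[of x] that e by (intro mult_pos_pos) (auto intro: add_nonneg_pos)
      ultimately show ?thesis by linarith
    qed
    then have "norm (p x - 1) < norm (p x + 1 + 2 * of_real e)"
      by (rule power_less_imp_less_base) simp
    then show ?thesis using den[of x] that by (simp add: w_def norm_divide)
  qed
  ultimately have wz: "norm (w z) \<le> norm z"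
    using Schwarz_Lemma(1)[of w z] z by simp
  define q where "q = (p z + of_real e) / (1 + of_real e)"
  have e1: "1 + complex_of_real e \<noteq> 0" using e
    by (metis add_pos_pos of_real_1 of_real_add of_real_eq_0_iff order_less_irrefl zero_less_one)
  have Re_q: "Re q = (Re (p z) + e) / (1 + e)"
  proof -
    have "q = (p z + of_real e) / of_real (1 + e)" by (simp add: q_def)
    then show ?thesis by (simp only: Re_divide_of_real) simp
  qed
  have rq: "Re q \<ge> 0" using pos[OF z] e by (simp add: Re_q)
  have "w z = (q - 1) / (q + 1)"
    using e1 by (simp add: w_def q_def divide_simps) (simp add: algebra_simps)
  moreover have q1: "q + 1 \<noteq> 0" using rq by (auto simp: complex_eq_iff)
  ultimately have le: "norm (q - 1) \<le> norm z * norm (q + 1)"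
    using wz by (simp add: norm_divide pos_divide_le_eq)
  have "(1 - norm z) / (1 + norm z) \<le> Re q"
  proof -
    define r where "r = norm z"
    have r: "0 \<le> r" "r < 1" using z by (auto simp: r_def)
    have "(norm (q - 1))^2 \<le> (r * norm (q + 1))^2"
      using le by (intro power_mono) (auto simp: r_def)
    then have "(Re q - 1)^2 + (Im q)^2 \<le> r^2 * ((Re q + 1)^2 + (Im q)^2)"
      by (simp add: cmod_power2 power_mult_distrib)
    moreover have "r^2 * (Im q)^2 \<le> (Im q)^2"
      using r by (intro mult_left_le_one_le) (auto simp: power_le_one)
    ultimately have "(Re q - 1)^2 \<le> (r * (Re q + 1))^2"
      unfolding power_mult_distrib distrib_left[of "r^2"] by linarith
    then have "\<bar>Re q - 1\<bar> \<le> r * (Re q + 1)"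
      using r rq by (metis abs_le_square_iff abs_of_nonneg add_nonneg_nonneg mult_nonneg_nonneg zero_le_one)
    then have "1 - r \<le> Re q * (1 + r)" by (simp add: algebra_simps)
    then show ?thesis using r by (simp add: r_def[symmetric] pos_divide_le_eq)
  qed
  also have "\<dots> \<le> Re (p z) + e"
    unfolding Re_q using pos[OF z] e by (simp add: divide_le_eq algebra_simps)
  finally show "(1 - norm z) / (1 + norm z) \<le> Re (p z) + e" .
qed

text \<open>The differential operator is inverted by integration along the radius: the derivative of \<open>x powr s * g (x * z)\<close>
with respect to \<open>x\<close> is \<open>x powr (s - 1)\<close> times \<open>s * g + z * deriv g\<close> at \<open>x * z\<close>.\<close>

lemma Re_has_integral_euler_re:
  assumes s: "s > 0" and g: "g holomorphic_on ball 0 1" and z: "z \<in> ball 0 1"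
  shows "((\<lambda>x. x powr (s - 1) * euler_re s g (of_real x * z)) has_integral Re (g z)) {0..1}"
proof -
  have mem: "of_real x * z \<in> ball 0 1" if "x \<in> {0..1}" for x :: real
    using that z mult_left_le_one_le[of "norm z" x] by (auto simp: norm_mult intro: le_less_trans)
  have "((\<lambda>x. x powr (s - 1) * euler_re s g (of_real x * z)) has_integral
     (1 powr s * Re (g (of_real 1 * z)) - 0 powr s * Re (g (of_real 0 * z)))) {0..1}"
  proof (rule fundamental_theorem_of_calculus_interior)
    have "continuous_on {0..1} (\<lambda>x::real. g (of_real x * z))"
      by (rule continuous_on_compose2[OF holomorphic_on_imp_continuous_on[OF g]])
         (use mem in \<open>auto intro!: continuous_intros\<close>)
    then show "continuous_on {0..1} (\<lambda>x::real. x powr s * Re (g (of_real x * z)))"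
      using s by (intro continuous_on_mult continuous_on_powr_unit continuous_on_Re)
    fix x :: real assume x: "x \<in> {0<..<1}"
    have "(g has_field_derivative deriv g (of_real x * z)) (at (of_real x * z))"
      using mem[of x] x g by (intro holomorphic_derivI[OF _ open_ball]) auto
    moreover have "((\<lambda>x. of_real x * z) has_vector_derivative z) (at x)"
      by (auto intro!: derivative_eq_intros)
    ultimately have "((g \<circ> (\<lambda>x. of_real x * z)) has_vector_derivative (z * deriv g (of_real x * z))) (at x)"
      using field_vector_diff_chain_at by blast
    then have "((\<lambda>x. g (of_real x * z)) has_vector_derivative (z * deriv g (of_real x * z))) (at x)"
      by (simp add: o_def)
    then have "((\<lambda>x. Re (g (of_real x * z))) has_real_derivative Re (z * deriv g (of_real x * z))) (at x)"
      using bounded_linear.has_vector_derivative[OF bounded_linear_Re]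
        has_real_derivative_iff_has_vector_derivative by blast
    from DERIV_mult[OF has_real_derivative_powr this]
    have "((\<lambda>x. x powr s * Re (g (of_real x * z))) has_real_derivative
       (s * x powr (s - 1) * Re (g (of_real x * z)) + x powr s * Re (z * deriv g (of_real x * z)))) (at x)"
      using x by (simp add: mult.commute del: times_complex.sel)
    moreover have "s * x powr (s - 1) * Re (g (of_real x * z)) + x powr s * Re (z * deriv g (of_real x * z))
      = x powr (s - 1) * euler_re s g (of_real x * z)"
      using powr_pred_mult[of x s, symmetric] x by (simp add: euler_re_def algebra_simps)
    ultimately show "((\<lambda>x. x powr s * Re (g (of_real x * z))) has_vector_derivative
       (x powr (s - 1) * euler_re s g (of_real x * z))) (at x)"
      by (simp add: has_real_derivative_iff_has_vector_derivative)
  qed simp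
  then show ?thesis by simp
qed

text \<open>Normalising \<open>s * g + z * deriv g\<close> gives a function of value \<open>1\<close> at \<open>0\<close> and nonnegative real part; its Harnack bound is
inserted into the radial integral, with \<open>norm z\<close> estimated by \<open>1\<close>.\<close>

lemma Re_quotient_lower:
  assumes s: "s > 0" and t: "t < 1" and g: "g \<in> quotients"
    and pos: "\<forall>z\<in>ball 0 1 - {0}. s * t \<le> euler_re s g z" and z: "z \<in> ball 0 1"
  shows "t + (1 - t) * xi0 s \<le> Re (g z)"
proof -
  have gh: "g holomorphic_on ball 0 1" and g0: "g 0 = 1" using g by (auto simp: quotients_def)
  define p where "p z = (of_real s * g z + z * deriv g z - of_real (s * t)) / of_real (s * (1 - t))" for z
  have Re_p: "Re (p z) = (euler_re s g z - s * t) / (s * (1 - t))" for z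
    unfolding p_def euler_re_def by (simp only: Re_divide_of_real) simp
  have st: "s * (1 - t) > 0" using s t by simp
  have "p holomorphic_on ball 0 1"
    unfolding p_def using st by (intro holomorphic_intros gh) auto
  moreover have "p 0 = of_real (s * (1 - t)) / of_real (s * (1 - t))"
    by (simp add: p_def g0 algebra_simps)
  then have "p 0 = 1" using s t by simp
  moreover have "0 \<le> Re (p x)" if "x \<in> ball 0 1" for x
  proof (cases "x = 0")
    case True
    then show ?thesis using \<open>p 0 = 1\<close> by simp
  next
    case False
    then show ?thesis using that pos st by (simp add: Re_p)
  qed
  ultimately have har: "(1 - norm x) / (1 + norm x) \<le> Re (p x)" if "x \<in> ball 0 1" for x
    using Harnack_lower that by blast
  have low: "s * (t + (1 - t) * ((1 - x) / (1 + x))) \<le> euler_re s g (of_real x * z)" if x: "x \<in> {0..1}" for x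
  proof -
    have xz: "norm (of_real x * z) = x * norm z" using x by (simp add: norm_mult)
    have le: "x * norm z \<le> x" using x z by (intro mult_right_le_one_le) auto
    have mem: "of_real x * z \<in> ball 0 1"
      using x z mult_left_le_one_le[of "norm z" x] by (auto simp: norm_mult intro: le_less_trans)
    have "(1 - x) / (1 + x) \<le> (1 - x * norm z) / (1 + x * norm z)"
      using le x by (intro frac_le) (auto intro: add_pos_nonneg)
    also have "\<dots> \<le> (euler_re s g (of_real x * z) - s * t) / (s * (1 - t))"
      using har[OF mem] unfolding xz Re_p .
    finally have "(1 - x) / (1 + x) * (s * (1 - t)) \<le> euler_re s g (of_real x * z) - s * t"
      using st by (simp only: pos_le_divide_eq)
    then show ?thesis by (simp add: algebra_simps)
  qed
  have "((\<lambda>x. t * (s * x powr (s - 1)) + (1 - t) * (s * x powr (s - 1) * ((1 - x) / (1 + x))))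
     has_integral (t * 1 + (1 - t) * xi0 s)) {0..1}"
    by (intro has_integral_add has_integral_mult_right has_integral_powr_pred xi0_has_integral s)
  moreover have "t * (s * x powr (s - 1)) + (1 - t) * (s * x powr (s - 1) * ((1 - x) / (1 + x)))
     \<le> x powr (s - 1) * euler_re s g (of_real x * z)" if "x \<in> {0..1}" for x
  proof -
    have "t * (s * x powr (s - 1)) + (1 - t) * (s * x powr (s - 1) * ((1 - x) / (1 + x)))
      = x powr (s - 1) * (s * (t + (1 - t) * ((1 - x) / (1 + x))))" by (simp add: algebra_simps)
    also have "\<dots> \<le> x powr (s - 1) * euler_re s g (of_real x * z)"
      using low[OF that] by (intro mult_left_mono) auto
    finally show ?thesis .
  qed
  ultimately have "t * 1 + (1 - t) * xi0 s \<le> Re (g z)"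
    using Re_has_integral_euler_re[OF s gh z] has_integral_le by blast
  then show ?thesis by simp
qed

lemma euler_re_shift: "euler_re s' g z = (s' - s) * Re (g z) + euler_re s g z"
  by (simp add: euler_re_def algebra_simps)

lemma mult_t_up: "s' > 0 \<Longrightarrow> s' * t_up (s, t) s' = (s' - s) * (t + (1 - t) * xi0 s) + s * t"
  by (simp add: t_up_def field_simps)

text \<open>Passing from \<open>s\<close> to \<open>s'\<close> adds \<open>(s' - s) * Re (g z)\<close>, and \<open>t_up (s, t) s'\<close> is what remains when both summands are
replaced by their lower bounds.\<close>

lemma frakA_subset_forward:
  assumes "0 < s" "s \<le> s'" "t < 1" "t' \<le> t_up (s, t) s'"
  shows "frakA s t \<subseteq> frakA s' t'"
  unfolding frakA_subset_iff
proof (intro ballI impI)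
  fix g z assume g: "g \<in> quotients" "\<forall>z\<in>ball 0 1 - {0}. s * t \<le> euler_re s g z" and z: "z \<in> ball (0::complex) 1 - {0}"
  have "s' * t' \<le> s' * t_up (s, t) s'" using assms by simp
  also have "\<dots> = (s' - s) * (t + (1 - t) * xi0 s) + s * t" using assms by (simp add: mult_t_up)
  also have "\<dots> \<le> (s' - s) * Re (g z) + euler_re s g z"
    using Re_quotient_lower[of s t g z] assms g z by (intro add_mono mult_left_mono) auto
  also have "\<dots> = euler_re s' g z" by (rule euler_re_shift[symmetric])
  finally show "s' * t' \<le> euler_re s' g z" .
qed

section \<open>Sharpness of the forward inclusions\<close>

lemma Re_inverse_one_minus:
  assumes "norm z < 1" shows "Re (1 / (1 - z)) > 1/2"
proof -
  define w where "w = 1 - z"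
  have w: "w \<noteq> 0" using assms by (auto simp: w_def)
  have "(norm (1 - w))^2 < 1^2" using assms by (intro power_strict_mono) (auto simp: w_def)
  then have "(norm w)^2 < 2 * Re w" unfolding cmod_power2 by (simp add: power2_eq_square algebra_simps)
  moreover have "Re (1 / w) = Re w / (norm w)^2" by (simp add: Re_divide cmod_power2)
  ultimately have "Re (1 / w) > 1/2" using w by (simp add: pos_less_divide_eq)
  then show ?thesis by (simp add: w_def)
qed

lemma cayley_nonneg: "norm z < 1 \<Longrightarrow> 0 \<le> Re ((1 + z) / (1 - z))"
proof -
  assume z: "norm z < 1"
  then have "1 - z \<noteq> 0" by auto
  then have "(1 + z) / (1 - z) = 1 / (1 - z) + 1 / (1 - z) - 1" by (simp add: field_simps)
  then have "Re ((1 + z) / (1 - z)) = Re (1 / (1 - z)) + Re (1 / (1 - z)) - 1"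
    by (simp only: minus_complex.sel plus_complex.sel one_complex.sel)
  then show ?thesis using Re_inverse_one_minus[OF z] by linarith
qed

text \<open>The equality case of Harnack's inequality is \<open>(1 + z) / (1 - z)\<close>, with Taylor coefficients \<open>1, 2, 2, \<dots>\<close>; the
operator multiplies the coefficient of index \<open>n\<close> by \<open>s + n\<close>, so the power series of \<open>h\<close> can be written down.\<close>

lemma extremal_quotient_exists:
  assumes s: "s > 0"
  obtains h where "h \<in> quotients"
    "\<And>z. z \<in> ball 0 1 \<Longrightarrow> of_real s * h z + z * deriv h z = of_real s * ((1 + z) / (1 - z))"
proof -
  define c :: "nat \<Rightarrow> complex" where "c n = (if n = 0 then 1 else of_real (2 * s / (s + n)))" for n
  define F where "F = Abs_fps c"
  have c_le: "norm (c n) \<le> 2" for n using s by (auto simp: c_def abs_if field_simps simp del: of_real_divide of_real_mult)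
  have rad: "fps_conv_radius F \<ge> 1"
    unfolding fps_conv_radius_def
  proof (rule conv_radius_geI_ex')
    fix r :: real assume r: "0 < r" "ereal r < 1"
    show "summable (\<lambda>n. fps_nth F n * of_real r ^ n)"
    proof (rule summable_comparison_test)
      show "summable (\<lambda>n. 2 * r ^ n)" using r by (intro summable_mult summable_geometric) auto
      show "\<exists>N. \<forall>n\<ge>N. norm (fps_nth F n * of_real r ^ n) \<le> 2 * r ^ n"
        using c_le r by (auto simp: F_def norm_mult norm_power intro!: mult_right_mono)
    qed
  qed
  define h where "h = eval_fps F"
  have lt: "ereal (norm z) < fps_conv_radius F" if "z \<in> ball 0 1" for z :: complex
  proof -
    have "ereal (norm z) < 1" using that by (simp add: one_ereal_def)
    then show ?thesis using rad by (rule less_le_trans)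
  qed
  have "h holomorphic_on ball 0 1"
    unfolding h_def using lt by (intro holomorphic_on_eval_fps) (auto simp: in_eball_iff)
  moreover have "h 0 = 1" by (simp add: h_def F_def c_def eval_fps_at_0)
  ultimately have "h \<in> quotients" by (simp add: quotients_def)
  moreover have "of_real s * h z + z * deriv h z = of_real s * ((1 + z) / (1 - z))" if z: "z \<in> ball 0 1" for z
  proof -
    have rad': "ereal (norm z) < fps_conv_radius (fps_deriv F)"
      using lt[OF z] fps_conv_radius_deriv[of F] by (rule less_le_trans)
    have 1: "(\<lambda>n. c n * z ^ n) sums h z"
      using sums_eval_fps[OF lt[OF z]] by (simp add: F_def h_def)
    have "(\<lambda>n. fps_nth (fps_deriv F) n * z ^ n * z) sums (eval_fps (fps_deriv F) z * z)"
      by (intro sums_mult2 sums_eval_fps rad')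
    then have "(\<lambda>n. of_nat (Suc n) * c (Suc n) * z ^ Suc n) sums (z * deriv h z)"
      using lt[OF z] by (simp add: F_def h_def eval_fps_deriv mult_ac)
    then have 2: "(\<lambda>n. of_nat n * c n * z ^ n) sums (z * deriv h z)"
      by (subst (asm) sums_Suc_iff) simp
    have "(\<lambda>n. of_real s * (c n * z ^ n) + of_nat n * c n * z ^ n) sums (of_real s * h z + z * deriv h z)"
      by (intro sums_add sums_mult 1 2)
    moreover have "of_real s * (c n * z ^ n) + of_nat n * c n * z ^ n
       = of_real (2 * s) * z ^ n - (if n = 0 then of_real s else 0)" for n
    proof (cases "n = 0")
      case True
      then show ?thesis by (simp add: c_def)
    next
      case False
      have "of_real s + of_nat n = complex_of_real (s + n)" by simp
      then have "(of_real s + of_nat n) * c n = of_real ((s + n) * (2 * s / (s + n)))"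
        using False by (simp only: c_def of_real_mult if_False)
      also have "(s + n) * (2 * s / (s + n)) = 2 * s" using s by (simp add: field_simps)
      finally have "(of_real s + of_nat n) * c n * z ^ n = of_real (2 * s) * z ^ n" by simp
      then show ?thesis using False by (simp add: algebra_simps)
    qed
    ultimately have "(\<lambda>n. of_real (2 * s) * z ^ n - (if n = 0 then of_real s else 0))
      sums (of_real s * h z + z * deriv h z)" by simp
    moreover have "(\<lambda>n. of_real (2 * s) * z ^ n - (if n = 0 then of_real s else 0))
      sums (of_real (2 * s) * (1 / (1 - z)) - of_real s)"
      using z by (intro sums_diff sums_mult geometric_sums sums_single) auto
    ultimately have "of_real s * h z + z * deriv h z = of_real (2 * s) * (1 / (1 - z)) - of_real s"
      by (rule sums_unique2)
    moreover have "1 - z \<noteq> 0" using z by auto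
    then have "of_real (2 * s) * (1 / (1 - z)) - of_real s = of_real s * ((1 + z) / (1 - z))"
      by (simp add: field_simps)
    ultimately show ?thesis by simp
  qed
  ultimately show ?thesis using that by blast
qed

text \<open>In the radial integral for \<open>h\<close> at \<open>-r\<close> the integrand exceeds that of \<open>xi0 s\<close> by at most \<open>2 * (1 - r)\<close> times
\<open>s * x powr (s - 1)\<close>, whose integral is \<open>1\<close>.\<close>

lemma extremal_quotient_near:
  assumes s: "s > 0" and h: "h \<in> quotients"
    and ode: "\<And>z. z \<in> ball 0 1 \<Longrightarrow> of_real s * h z + z * deriv h z = of_real s * ((1 + z) / (1 - z))"
    and r: "0 < r" "r < 1"
  shows "Re (h (- of_real r)) \<le> xi0 s + 2 * (1 - r)"
proof -
  have h': "h holomorphic_on ball 0 1" using h by (simp add: quotients_def)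
  have "((\<lambda>x. x powr (s - 1) * euler_re s h (of_real x * - of_real r)) has_integral Re (h (- of_real r))) {0..1}"
    by (rule Re_has_integral_euler_re[OF s h']) (use r in auto)
  moreover have "((\<lambda>x. s * x powr (s - 1) * ((1 - x) / (1 + x)) + 2 * (1 - r) * (s * x powr (s - 1)))
     has_integral (xi0 s + 2 * (1 - r) * 1)) {0..1}"
    by (intro has_integral_add has_integral_mult_right has_integral_powr_pred xi0_has_integral s)
  moreover have "x powr (s - 1) * euler_re s h (of_real x * - of_real r)
     \<le> s * x powr (s - 1) * ((1 - x) / (1 + x)) + 2 * (1 - r) * (s * x powr (s - 1))"
    if x: "x \<in> {0..1}" for x
  proof -
    have xr: "0 \<le> x * r" "x * r < 1"
      using x r le_less_trans[OF mult_left_le_one_le[of r x] r(2)] by auto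
    have mem: "complex_of_real x * - of_real r \<in> ball 0 1" using xr by (simp flip: of_real_mult)
    have "(1 + complex_of_real x * - of_real r) / (1 - complex_of_real x * - of_real r)
       = of_real ((1 - x * r) / (1 + x * r))" by simp
    then have "of_real s * h (of_real x * - of_real r) + (of_real x * - of_real r) * deriv h (of_real x * - of_real r)
       = of_real (s * ((1 - x * r) / (1 + x * r)))"
      unfolding ode[OF mem] by simp
    then have L: "euler_re s h (of_real x * - of_real r) = s * ((1 - x * r) / (1 + x * r))"
      unfolding euler_re_def by (simp only: Re_complex_of_real)
    have "(1 - x * r) / (1 + x * r) - (1 - x) / (1 + x) = 2 * (1 - r) * (x / ((1 + x * r) * (1 + x)))"
      using x xr by (simp add: field_simps)
    also have "\<dots> \<le> 2 * (1 - r) * 1"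
    proof (intro mult_left_mono)
      have "x \<le> (1 + x * r) * (1 + x)" using x xr
        by (smt (verit) atLeastAtMost_iff mult_le_cancel_right1)
      then show "x / ((1 + x * r) * (1 + x)) \<le> 1" using x xr by (simp add: divide_le_eq)
    qed (use r in auto)
    finally have "(1 - x * r) / (1 + x * r) \<le> (1 - x) / (1 + x) + 2 * (1 - r)" by simp
    then have "x powr (s - 1) * s * ((1 - x * r) / (1 + x * r)) \<le> x powr (s - 1) * s * ((1 - x) / (1 + x) + 2 * (1 - r))"
      using s by (intro mult_left_mono) auto
    then show ?thesis unfolding L by (simp add: algebra_simps)
  qed
  ultimately have "Re (h (- of_real r)) \<le> xi0 s + 2 * (1 - r) * 1" by (rule has_integral_le)
  then show ?thesis by simp
qed

text \<open>For the extremal quotient both lower bounds in the forward inclusion are approached simultaneously as \<open>z\<close> tends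
to \<open>-1\<close>.\<close>

lemma frakA_subset_forward_iff:
  assumes "0 < s" "s \<le> s'" "t < 1"
  shows "frakA s t \<subseteq> frakA s' t' \<longleftrightarrow> t' \<le> t_up (s, t) s'"
proof
  assume "t' \<le> t_up (s, t) s'"
  then show "frakA s t \<subseteq> frakA s' t'" using frakA_subset_forward assms by blast
next
  assume sub: "frakA s t \<subseteq> frakA s' t'"
  obtain h where h: "h \<in> quotients"
    and ode: "\<And>z. z \<in> ball 0 1 \<Longrightarrow> of_real s * h z + z * deriv h z = of_real s * ((1 + z) / (1 - z))"
    using extremal_quotient_exists[OF assms(1)] by blast
  have hh: "h holomorphic_on ball 0 1" and h0: "h 0 = 1" using h by (auto simp: quotients_def)
  define g where "g z = of_real t + of_real (1 - t) * h z" for z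
  have gu: "g \<in> quotients" unfolding quotients_def g_def using hh h0
    by (auto intro!: holomorphic_intros)
  have dg: "deriv g z = of_real (1 - t) * deriv h z" if "z \<in> ball 0 1" for z
    unfolding g_def using that holomorphic_derivI[OF hh open_ball that]
    by (intro DERIV_imp_deriv) (auto intro!: derivative_eq_intros)
  have Lg: "euler_re s g z = s * t + s * (1 - t) * Re ((1 + z) / (1 - z))" if z: "z \<in> ball 0 1" for z
  proof -
    have "of_real s * g z + z * deriv g z = of_real (s * t) + of_real (1 - t) * (of_real s * h z + z * deriv h z)"
      by (simp add: g_def dg[OF z] algebra_simps)
    also have "\<dots> = of_real (s * t) + of_real (s * (1 - t)) * ((1 + z) / (1 - z))"
      unfolding ode[OF z] by simp
    finally show ?thesis unfolding euler_re_def
      by (simp only: plus_complex.sel Re_complex_of_real times_complex.sel Im_complex_of_real)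
  qed
  have "\<forall>z\<in>ball 0 1 - {0}. s * t \<le> euler_re s g z"
    using Lg cayley_nonneg assms by auto
  then have low: "s' * t' \<le> euler_re s' g z" if "z \<in> ball 0 1 - {0}" for z
    using sub gu that unfolding frakA_subset_iff by blast
  define M where "M = 2 * (s' - s) * (1 - t) + s * (1 - t)"
  have M: "M > 0" using assms by (auto simp: M_def intro: add_nonneg_pos)
  have bound: "s' * t' \<le> s' * t_up (s, t) s' + d * M" if d: "0 < d" "d < 1" for d
  proof -
    define z where "z = - complex_of_real (1 - d)"
    have z: "z \<in> ball 0 1 - {0}" using d by (auto simp: z_def simp del: of_real_diff)
    have "(1 + z) / (1 - z) = of_real (d / (2 - d))" by (simp add: z_def)
    then have "Re ((1 + z) / (1 - z)) = d / (2 - d)" by (simp only: Re_complex_of_real)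
    also have "\<dots> \<le> d / 1" using d by (intro divide_left_mono) auto
    finally have c: "Re ((1 + z) / (1 - z)) \<le> d" by simp
    have hz: "Re (h z) \<le> xi0 s + 2 * d"
      using extremal_quotient_near[OF assms(1) h ode, of "1 - d"] d by (simp add: z_def)
    have "Re (g z) = t + (1 - t) * Re (h z)" by (simp add: g_def)
    also have "\<dots> \<le> t + (1 - t) * (xi0 s + 2 * d)" using hz assms by simp
    finally have gz: "Re (g z) \<le> t + (1 - t) * (xi0 s + 2 * d)" .
    have "s' * t' \<le> (s' - s) * Re (g z) + euler_re s g z" using low[OF z] euler_re_shift by simp
    also have "\<dots> \<le> (s' - s) * (t + (1 - t) * (xi0 s + 2 * d)) + (s * t + s * (1 - t) * d)"
      using gz c assms Lg[of z] z by (intro add_mono mult_left_mono) (auto intro!: mult_left_mono)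
    also have "\<dots> = s' * t_up (s, t) s' + d * M"
      using assms by (simp add: mult_t_up M_def algebra_simps)
    finally show ?thesis .
  qed
  have "s' * t' \<le> s' * t_up (s, t) s'"
  proof (rule ccontr)
    assume "\<not> ?thesis"
    then have e: "s' * t' - s' * t_up (s, t) s' > 0" (is "?e > 0") by simp
    define d where "d = min (1/2) (?e / (2 * M))"
    have "0 < d" "d < 1" using e M by (auto simp: d_def)
    moreover have "d * M \<le> ?e / 2"
      using M by (simp add: d_def min_def field_simps)
    ultimately have "s' * t' \<le> s' * t_up (s, t) s' + ?e / 2" using bound[of d] by linarith
    then show False using e by argo
  qed
  then show "t' \<le> t_up (s, t) s'" using assms by simp
qed

section \<open>Absence of backward inclusions\<close>

lemma norm_times_Ln_le:
  assumes "w \<noteq> 0" "norm w < 2"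
  shows "norm (w * Ln w) \<le> 2 + 2 * pi"
proof -
  have "norm w * \<bar>ln (norm w)\<bar> \<le> 2"
  proof (cases "norm w \<le> 1")
    case True
    have "ln (inverse (norm w)) \<le> inverse (norm w) - 1"
      using assms by (intro ln_le_minus_one) auto
    then have "\<bar>ln (norm w)\<bar> \<le> inverse (norm w) - 1"
      using True assms by (simp add: ln_inverse)
    then have "norm w * \<bar>ln (norm w)\<bar> \<le> norm w * (inverse (norm w) - 1)"
      by (intro mult_left_mono) auto
    also have "\<dots> = 1 - norm w" using assms by (simp add: field_simps)
    finally show ?thesis using norm_ge_zero[of w] by linarith
  next
    case False
    have "\<bar>ln (norm w)\<bar> \<le> 1"
      using False assms ln_le_minus_one[of "norm w"] by simp
    then have "norm w * \<bar>ln (norm w)\<bar> \<le> 2 * 1"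
      using assms by (intro mult_mono) auto
    then show ?thesis by simp
  qed
  moreover have "norm w * \<bar>Im (Ln w)\<bar> \<le> 2 * pi"
    using assms Im_Ln_le_pi[of w] mpi_less_Im_Ln[of w] by (intro mult_mono) auto
  moreover have "norm (Ln w) \<le> \<bar>ln (norm w)\<bar> + \<bar>Im (Ln w)\<bar>"
    using cmod_le[of "Ln w"] assms by simp
  then have "norm w * norm (Ln w) \<le> norm w * (\<bar>ln (norm w)\<bar> + \<bar>Im (Ln w)\<bar>)"
    by (intro mult_left_mono) auto
  ultimately show ?thesis by (simp add: norm_mult distrib_left)
qed

text \<open>For \<open>s' < s\<close> the term \<open>(s' - s) * Re (g z)\<close> is harmful, so it suffices to find \<open>g\<close> with \<open>Re g\<close> unbounded above
although \<open>Re (s * g + z * deriv g)\<close> is bounded below everywhere, and bounded above along a path on which \<open>Re g\<close>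
tends to infinity. Start from \<open>L z = - Ln (1 - z)\<close>: here \<open>z * deriv L z = 1 / (1 - z) - 1\<close> has real part above
\<open>-1/2\<close>, but \<open>s * L\<close> is itself unbounded. Adding \<open>s * (1 - z) * L z\<close>, whose derivative contains \<open>- s * L\<close>,
cancels this term up to multiples of \<open>(1 - z) * L z\<close> and \<open>z\<close>, which are bounded. A small multiple \<open>e\<close> of the result is added
to \<open>1\<close> to respect the bound \<open>s * t\<close>.\<close>

lemma frakA_not_subset_backward:
  assumes s: "0 < s" and t: "t < 1" and s': "s' < s"
  shows "\<not> frakA s t \<subseteq> frakA s' t'"
proof
  assume sub: "frakA s t \<subseteq> frakA s' t'"
  define B where "B = 2 + 2 * pi"
  define M where "M = s * (1 + s) * B + 1 + s"
  have B: "B > 0" using pi_gt_zero by (simp add: B_def add_pos_pos)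
  have M: "M > 0" using s B by (auto simp: M_def intro!: add_pos_pos mult_pos_pos)
  define e where "e = s * (1 - t) / M"
  have e: "e > 0" using s t M by (simp add: e_def)
  define L where "L z = - Ln (1 - z)" for z :: complex
  define g where "g z = 1 + of_real e * (L z + of_real s * ((1 - z) * L z))" for z
  have ne: "1 - z \<noteq> 0" if "z \<in> ball 0 1" for z :: complex using that by auto
  have nR: "1 - z \<notin> \<real>\<^sub>\<le>\<^sub>0" if "z \<in> ball 0 1" for z :: complex
  proof -
    have "Re z < 1" using that abs_Re_le_cmod[of z] by auto
    then show ?thesis by (auto simp: complex_nonpos_Reals_iff)
  qed
  have "g holomorphic_on ball 0 1"
    unfolding g_def L_def using nR by (intro holomorphic_intros) auto
  then have gu: "g \<in> quotients" by (simp add: quotients_def g_def L_def)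
  have dg: "deriv g z = of_real e * (1 / (1 - z) + of_real s * (1 - L z))" if z: "z \<in> ball 0 1" for z
  proof -
    have dL: "(L has_field_derivative 1 / (1 - z)) (at z)"
      unfolding L_def using nR[OF z] by (auto intro!: derivative_eq_intros simp: inverse_eq_divide)
    have "(g has_field_derivative 0 + of_real e *
        (1 / (1 - z) + of_real s * ((0 - 1) * L z + 1 / (1 - z) * (1 - z)))) (at z)"
      unfolding g_def
      by (intro DERIV_add DERIV_const DERIV_cmult DERIV_mult DERIV_diff DERIV_ident dL)
    then have "deriv g z = 0 + of_real e *
        (1 / (1 - z) + of_real s * ((0 - 1) * L z + 1 / (1 - z) * (1 - z)))"
      by (rule DERIV_imp_deriv)
    then show ?thesis using ne[OF z] by simp
  qed
  define N where "N z = (1 - z) * L z" for z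
  have N: "norm (N z) \<le> B" if z: "z \<in> ball 0 1" for z
  proof -
    have "norm (1 - z) < 2" using z norm_triangle_ineq4[of 1 z] by simp
    then have "norm ((1 - z) * Ln (1 - z)) \<le> B"
      unfolding B_def by (intro norm_times_Ln_le ne z)
    then show ?thesis by (simp add: N_def L_def norm_mult)
  qed
  have Re_N: "\<bar>Re (N z)\<bar> \<le> B" if "z \<in> ball 0 1" for z
    using N[OF that] abs_Re_le_cmod[of "N z"] by linarith
  have Lg: "euler_re s g z = s + e * (s * (1 + s) * Re (N z) + (Re (1 / (1 - z)) - 1) + s * Re z)"
    if z: "z \<in> ball 0 1" for z
  proof -
    have z1: "z / (1 - z) = 1 / (1 - z) - 1" using ne[OF z] by (simp add: field_simps)
    have "of_real s * g z + z * deriv g z = of_real s + of_real e *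
       (of_real s * L z + of_real (s * s) * N z + z / (1 - z) + of_real s * z - of_real s * (z * L z))"
      unfolding dg[OF z] by (simp add: g_def N_def algebra_simps)
    also have "\<dots> = of_real s + of_real e * (of_real (s * (1 + s)) * N z + (1 / (1 - z) - 1) + of_real s * z)"
      unfolding z1 by (simp add: N_def algebra_simps)
    finally show ?thesis unfolding euler_re_def
      by (simp only: plus_complex.sel minus_complex.sel one_complex.sel Re_complex_of_real times_complex.sel Im_complex_of_real mult_zero_left diff_zero)
  qed
  have "s * t \<le> euler_re s g z" if z: "z \<in> ball 0 1" for z
  proof -
    have "s * (1 + s) * Re (N z) \<ge> s * (1 + s) * (- B)"
      using Re_N[OF z] s by (intro mult_left_mono) auto
    moreover have "Re (1 / (1 - z)) \<ge> 0" using Re_inverse_one_minus[of z] z by simp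
    moreover have "s * Re z \<ge> s * (- 1)"
      using z abs_Re_le_cmod[of z] s by (intro mult_left_mono) auto
    ultimately have "- M \<le> s * (1 + s) * Re (N z) + (Re (1 / (1 - z)) - 1) + s * Re z"
      by (simp add: M_def)
    then have "e * (- M) \<le> e * (s * (1 + s) * Re (N z) + (Re (1 / (1 - z)) - 1) + s * Re z)"
      using e by (intro mult_left_mono) auto
    moreover have "e * M = s * (1 - t)" using M by (simp add: e_def)
    then have "e * (- M) = s * t - s" by (simp add: algebra_simps)
    ultimately show ?thesis using Lg[OF z] by linarith
  qed
  then have low: "s' * t' \<le> euler_re s' g z" if "z \<in> ball 0 1 - {0}" for z
    using sub gu that unfolding frakA_subset_iff by blast
  \<comment> \<open>The map \<open>z \<mapsto> 1 / (1 - z)\<close> sends the disc onto the half plane of real parts above \<open>1/2\<close>. On the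
    line of real part \<open>1\<close>, where \<open>w\<close> is taken, \<open>1 / (1 - z) - 1\<close> contributes nothing, while \<open>Re (L z) = ln (norm w)\<close>
    is as large as desired; \<open>X\<close> is chosen to make the final comparison fail by at least \<open>1\<close>.\<close>
  define C where "C = s + e * (s * (1 + s) * B + s) - s' * t' - (s - s') * (1 - e * s * B)"
  define X where "X = (\<bar>C\<bar> + 1) / ((s - s') * e)"
  define w where "w = Complex 1 (exp X)"
  define z where "z = 1 - 1 / w"
  have w0: "w \<noteq> 0" by (simp add: w_def complex_eq_iff)
  have wz: "1 / (1 - z) = w" by (simp add: z_def)
  have nw: "norm w \<ge> exp X" using abs_Im_le_cmod[of w] by (simp add: w_def)
  have "norm z < 1"
  proof -
    have "norm (w - 1) < norm w"
      by (rule power_less_imp_less_base[of _ 2]) (simp_all add: w_def cmod_power2)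
    moreover have "z = (w - 1) / w" using w0 by (simp add: z_def field_simps)
    ultimately show ?thesis using w0 by (simp add: norm_divide)
  qed
  moreover have "z \<noteq> 0"
  proof
    assume "z = 0"
    then have "w = 1" using w0 by (simp add: z_def field_simps)
    then show False by (simp add: w_def complex_eq_iff)
  qed
  ultimately have z: "z \<in> ball 0 1 - {0}" by simp
  have "Re (L z) = ln (norm w)"
  proof -
    have "1 - z = inverse w" by (simp add: z_def field_simps)
    then show ?thesis using w0 by (simp add: L_def norm_inverse ln_inverse)
  qed
  also have "\<dots> \<ge> X" using nw w0 by (simp add: ln_ge_iff)
  finally have LX: "Re (L z) \<ge> X" .
  have "Re (g z) = 1 + e * (Re (L z) + s * Re (N z))" by (simp add: g_def N_def)
  also have "\<dots> \<ge> 1 + e * (X + s * (- B))"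
    using LX Re_N[of z] z e s by (intro add_left_mono mult_left_mono add_mono) auto
  finally have gz: "Re (g z) \<ge> 1 + e * (X + s * (- B))" .
  have "euler_re s g z = s + e * (s * (1 + s) * Re (N z) + s * Re z)"
    using Lg[of z] z wz by (simp add: w_def)
  also have "\<dots> \<le> s + e * (s * (1 + s) * B + s * 1)"
    using Re_N[of z] z e s abs_Re_le_cmod[of z] by (intro add_left_mono mult_left_mono add_mono) auto
  finally have Lz: "euler_re s g z \<le> s + e * (s * (1 + s) * B + s)" by simp
  have "s' * t' \<le> euler_re s g z - (s - s') * Re (g z)"
    using low[OF z] euler_re_shift[of s' g z s] by (simp add: algebra_simps)
  also have "\<dots> \<le> s + e * (s * (1 + s) * B + s) - (s - s') * (1 + e * (X + s * (- B)))"
    using Lz gz s' by (intro diff_mono mult_left_mono) auto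
  also have "\<dots> = C + s' * t' - (s - s') * e * X" by (simp add: C_def algebra_simps)
  also have "(s - s') * e * X = \<bar>C\<bar> + 1" using s' e by (simp add: X_def)
  finally show False by linarith
qed

section \<open>The degenerate classes\<close>

text \<open>Otherwise the image would be open and contain \<open>0\<close>, hence points of negative real part.\<close>

lemma zero_if_Re_nonneg:
  assumes q: "q holomorphic_on ball 0 1" and q0: "q 0 = 0"
    and pos: "\<And>z. z \<in> ball 0 1 \<Longrightarrow> 0 \<le> Re (q z)" and z: "z \<in> ball 0 1"
  shows "q z = 0"
proof (cases "q constant_on ball 0 1")
  case True
  then show ?thesis using q0 z unfolding constant_on_def by (metis centre_in_ball zero_less_one)
next
  case False
  have "open (q ` ball 0 1)"
    by (rule open_mapping_thm[OF q _ _ _ _ False]) auto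
  moreover have "0 \<in> q ` ball 0 1" using q0 by force
  ultimately obtain d where d: "d > 0" "ball 0 d \<subseteq> q ` ball 0 1" by (meson openE)
  then have "- of_real (d / 2) \<in> q ` ball 0 1" by (auto intro!: subsetD[OF d(2)] simp del: of_real_divide)
  then obtain x where "x \<in> ball 0 1" "q x = - of_real (d / 2)" by auto
  then have "Re (q x) < 0" "x \<in> ball 0 1" using d by auto
  then show ?thesis using pos[of x] by simp
qed

text \<open>If \<open>s = 0\<close>, then \<open>z * deriv g z\<close> has nonnegative real part and vanishes at \<open>0\<close>, so it is zero. If \<open>t = 1\<close>, then
\<open>g\<close> satisfies the condition for every smaller \<open>t\<close>, and letting \<open>t\<close> tend to \<open>1\<close> in the lower bound for \<open>Re g\<close>
shows that \<open>g z - 1\<close> has nonnegative real part and vanishes at \<open>0\<close>.\<close>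

lemma quotient_trivial:
  assumes g: "g \<in> quotients" and s: "s = 0 \<or> (0 < s \<and> t = 1)"
    and pos: "\<forall>z\<in>ball 0 1 - {0}. s * t \<le> euler_re s g z" and z: "z \<in> ball 0 1"
  shows "g z = 1"
proof -
  have gh: "g holomorphic_on ball 0 1" and g0: "g 0 = 1" using g by (auto simp: quotients_def)
  from s show ?thesis
  proof
    assume s0: "s = 0"
    have dh: "deriv g holomorphic_on ball 0 1" using gh by (rule holomorphic_deriv) simp
    have zero: "x * deriv g x = 0" if "x \<in> ball 0 1" for x
    proof (rule zero_if_Re_nonneg[OF _ _ _ that])
      show "(\<lambda>x. x * deriv g x) holomorphic_on ball 0 1" by (intro holomorphic_intros dh)
      show "0 \<le> Re (y * deriv g y)" if "y \<in> ball 0 1" for y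
        using pos s0 that by (cases "y = 0") (auto simp: euler_re_def)
    qed simp
    have "deriv g x = 0" if x: "x \<in> ball 0 1" for x
    proof (cases "x = 0")
      case True
      show ?thesis
        using deriv_quotient[OF dh, of "\<lambda>_. 0" 0] zero True by simp
    next
      case False
      then show ?thesis using zero[OF x] by simp
    qed
    then have "(g has_field_derivative 0) (at x within ball 0 1)" if "x \<in> ball 0 1" for x
      using that holomorphic_derivI[OF gh open_ball that] by (metis has_field_derivative_at_within)
    then obtain c where "\<forall>x\<in>ball 0 1. g x = c"
      using has_field_derivative_zero_constant[of "ball 0 1" g] by auto
    then show ?thesis using g0 z by (metis centre_in_ball zero_less_one)
  next
    assume st: "0 < s \<and> t = 1"
    have 1: "1 \<le> Re (g x)" if x: "x \<in> ball 0 1" for x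
    proof (rule dense_le)
      fix t' :: real
      show "t' \<le> Re (g x)" if "t' < 1"
      proof -
        have "\<forall>z\<in>ball 0 1 - {0}. s * t' \<le> euler_re s g z"
          using pos st that by (smt (verit) mult_left_mono)
        then have "t' + (1 - t') * xi0 s \<le> Re (g x)"
          using Re_quotient_lower[of s t' g x] st that g x by blast
        moreover have "(1 - t') * xi0 s \<ge> 0" using xi0_pos[of s] st that by simp
        ultimately show ?thesis by linarith
      qed
    qed
    have "g z - 1 = 0"
    proof (intro zero_if_Re_nonneg[of "\<lambda>z. g z - 1", OF _ _ _ z])
      show "(\<lambda>z. g z - 1) holomorphic_on ball 0 1" by (intro holomorphic_intros gh)
    qed (use g0 1 in auto)
    then show ?thesis by simp
  qed
qed

text \<open>A degenerate class contains the identity of the disc only, and the identity lies in all classes.\<close>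

lemma frakA_trivial_subset:
  assumes "s = 0 \<or> (0 < s \<and> t = 1)" "0 \<le> s'" "t' \<le> 1"
  shows "frakA s t \<subseteq> frakA s' t'"
  unfolding frakA_subset_iff
proof (intro ballI impI)
  fix g z assume g: "g \<in> quotients" "\<forall>z\<in>ball 0 1 - {0}. s * t \<le> euler_re s g z"
    and z: "z \<in> ball (0::complex) 1 - {0}"
  have 1: "g x = 1" if "x \<in> ball 0 1" for x
    using quotient_trivial[OF g(1) assms(1) g(2) that] .
  have "(g has_field_derivative 0) (at z)"
    by (rule has_field_derivative_transform_within_open[OF DERIV_const open_ball[of 0 1]])
       (use z 1 in auto)
  then have "deriv g z = 0" by (rule DERIV_imp_deriv)
  then have "euler_re s' g z = s'" using 1[of z] z by (simp add: euler_re_def)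
  then show "s' * t' \<le> euler_re s' g z" using assms by (simp add: mult_left_le)
qed

section \<open>Quasi-suprema and quasi-infima\<close>

text \<open>Inclusion between the sets has thus become a relation between points: \<open>(s', t')\<close> must lie to the right of \<open>(s, t)\<close>, on or
below its forward curve.\<close>

lemma frakA_nontrivial_subset_iff:
  assumes "0 < s" "t < 1"
  shows "frakA s t \<subseteq> frakA s' t' \<longleftrightarrow> s \<le> s' \<and> t' \<le> t_up (s, t) s'"
  using assms frakA_subset_forward_iff frakA_not_subset_backward by (meson not_le)

lemma t_up_less_mono:
  assumes "0 < a" "a \<le> b" shows "t_up (a, t) b < t_up (a, t') b \<longleftrightarrow> t < t'"
  using t_up_mono[OF assms] by (metis not_le)

theorem theorem4p4:
  fixes s1 t1 s2 t2 :: real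
  assumes "(s1, t1) \<in> Omega" and "(s2, t2) \<in> Omega"
    and "s1 < s2" and "t2 > t_up (s1, t1) s2"
  shows "qsup (frakA s1 t1) (frakA s2 t2)
           = {frakA s (min (t_up (s1, t1) s) (t_up (s2, t2) s)) | s. s \<ge> s2}
       \<and> qinf (frakA s1 t1) (frakA s2 t2)
           = {frakA s (max (t_down (s1, t1) s) (t_down (s2, t2) s)) | s.
                0 < s \<and> s \<le> s1 \<and> max (t_down (s1, t1) s) (t_down (s2, t2) s) \<ge> 0}"
proof -
  have t1: "0 \<le> t1" "t1 < 1" and t2: "0 \<le> t2" "t2 < 1" and "0 \<le> s1"
    using assms(1,2) by (auto simp: Omega_def)
  \<comment> \<open>The forward curve of a point with \<open>s1 = 0\<close> is constantly \<open>1\<close>, and no \<open>t2 < 1\<close> lies above it.\<close>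
  have s1: "0 < s1"
  proof (rule ccontr)
    assume "\<not> 0 < s1"
    with \<open>0 \<le> s1\<close> have "t_up (s1, t1) s2 = 1" by (simp add: t_up_def xi0_def)
    with assms(4) t2 show False by simp
  qed
  have s2: "0 < s2" using s1 assms(3) by simp
  let ?A1 = "frakA s1 t1" and ?A2 = "frakA s2 t2"
  define \<tau>1 where "\<tau>1 s = min (t_up (s1, t1) s) (t_up (s2, t2) s)" for s
  define \<tau>2 where "\<tau>2 s = max (t_down (s1, t1) s) (t_down (s2, t2) s)" for s

  have up_iff: "?A1 \<union> ?A2 \<subseteq> frakA s t \<longleftrightarrow> s2 \<le> s \<and> t \<le> \<tau>1 s" for s t
    using frakA_nontrivial_subset_iff[OF s1 t1(2), of s t] frakA_nontrivial_subset_iff[OF s2 t2(2), of s t]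
      assms(3) by (auto simp: \<tau>1_def)
  have \<tau>1_range: "0 \<le> \<tau>1 s" "\<tau>1 s < 1" if "s2 \<le> s" for s
    using that t_up_ge[OF s1, of s t1] t_up_ge[OF s2, of s t2] t_up_less_1[OF s1, of s t1] t1 t2 assms(3)
    by (auto simp: \<tau>1_def)
  \<comment> \<open>No point of the graph of \<open>\<tau>1\<close> lies on or below the forward curve of an earlier one. At \<open>s' = s2\<close> the curve
    of \<open>P2\<close> itself gives no strictness; there \<open>\<tau>1\<close> follows the curve of \<open>P1\<close>, which passes strictly below \<open>P2\<close>.\<close>
  have \<tau>1_strict: "t_up (s', \<tau>1 s') s < \<tau>1 s" if "s2 \<le> s'" "s' < s" for s s'
  proof -
    have s': "0 < s'" using s2 that by simp
    have "t_up (s', \<tau>1 s') s \<le> t_up (s', t_up (s1, t1) s') s"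
      using t_up_mono[OF s'] that by (simp add: \<tau>1_def)
    also have "\<dots> < t_up (s1, t1) s" using t_up_two_steps_less s1 that assms(3) t1 by simp
    finally have 1: "t_up (s', \<tau>1 s') s < t_up (s1, t1) s" .
    have 2: "t_up (s', \<tau>1 s') s < t_up (s2, t2) s"
    proof (cases "s' = s2")
      case True
      then have "\<tau>1 s' < t2" using assms(4) by (simp add: \<tau>1_def)
      then show ?thesis using True t_up_less_mono[OF s2, of s] that by simp
    next
      case False
      have "t_up (s', \<tau>1 s') s \<le> t_up (s', t_up (s2, t2) s') s"
        using t_up_mono[OF s'] that by (simp add: \<tau>1_def)
      also have "\<dots> < t_up (s2, t2) s" using t_up_two_steps_less s2 that False t2 by simp
      finally show ?thesis .
    qed
    show ?thesis using 1 2 by (simp add: \<tau>1_def)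
  qed

  have sup: "qsup ?A1 ?A2 = {frakA s (\<tau>1 s) | s. s2 \<le> s}"
  proof (intro equalityI subsetI)
    fix A assume A: "A \<in> qsup ?A1 ?A2"
    then obtain s t where st: "A = frakA s t" "0 \<le> s" "0 \<le> t" "t \<le> 1"
      by (auto simp: qsup_def frakA_family_def)
    have ub: "s2 \<le> s" "t \<le> \<tau>1 s"
      using A up_iff[of s t] st(1) by (auto simp: qsup_def)
    have "t = \<tau>1 s"
    proof (rule ccontr)
      assume "t \<noteq> \<tau>1 s"
      then have lt: "t < \<tau>1 s" using ub by simp
      have s: "0 < s" using s2 ub by simp
      have "frakA s (\<tau>1 s) \<subseteq> frakA s t"
        using frakA_nontrivial_subset_iff[OF s, of "\<tau>1 s" s t] \<tau>1_range[OF ub(1)] lt t_up_self[OF s] by simp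
      moreover have "\<not> frakA s t \<subseteq> frakA s (\<tau>1 s)"
        using frakA_nontrivial_subset_iff[OF s, of t s "\<tau>1 s"] \<tau>1_range[OF ub(1)] lt t_up_self[OF s] by simp
      moreover have "frakA s (\<tau>1 s) \<in> frakA_family"
        unfolding frakA_family_def using \<tau>1_range[OF ub(1)] s by force
      moreover have "?A1 \<union> ?A2 \<subseteq> frakA s (\<tau>1 s)" using up_iff ub(1) by simp
      ultimately show False using A st(1) unfolding qsup_def by blast
    qed
    then show "A \<in> {frakA s (\<tau>1 s) | s. s2 \<le> s}" using st ub by blast
  next
    fix A assume "A \<in> {frakA s (\<tau>1 s) | s. s2 \<le> s}"
    then obtain s where s: "A = frakA s (\<tau>1 s)" "s2 \<le> s" by blast
    have fam: "A \<in> frakA_family"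
      unfolding frakA_family_def s(1) using \<tau>1_range[OF s(2)] s2 s(2) by force
    have "\<not> A' \<subset> A" if A': "A' \<in> frakA_family" "?A1 \<union> ?A2 \<subseteq> A'" for A'
    proof
      assume sub: "A' \<subset> A"
      obtain s' t' where st': "A' = frakA s' t'" using A'(1) by (auto simp: frakA_family_def)
      have ub: "s2 \<le> s'" "t' \<le> \<tau>1 s'" using A'(2) up_iff st' by auto
      have s': "0 < s'" using ub s2 by simp
      have t': "t' < 1" using ub \<tau>1_range[OF ub(1)] by simp
      have le: "s' \<le> s" "\<tau>1 s \<le> t_up (s', t') s"
        using sub frakA_nontrivial_subset_iff[OF s' t', of s "\<tau>1 s"] st' s(1) by auto
      have "s' = s"
      proof (rule ccontr)
        assume "s' \<noteq> s"
        then have "s' < s" using le by simp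
        then have "t_up (s', \<tau>1 s') s < \<tau>1 s" using \<tau>1_strict ub by simp
        moreover have "t_up (s', t') s \<le> t_up (s', \<tau>1 s') s" using t_up_mono[OF s' le(1)] ub by simp
        ultimately show False using le by simp
      qed
      then have "t' = \<tau>1 s" using le ub t_up_self[OF s'] by simp
      with \<open>s' = s\<close> sub st' s(1) show False by simp
    qed
    then show "A \<in> qsup ?A1 ?A2"
      using fam up_iff[of s "\<tau>1 s"] s unfolding qsup_def by blast
  qed

  have low_iff: "frakA s t \<subseteq> ?A1 \<inter> ?A2 \<longleftrightarrow> s \<le> s1 \<and> \<tau>2 s \<le> t" if "0 < s" "t < 1" for s t
    using frakA_nontrivial_subset_iff[OF that, of s1 t1] frakA_nontrivial_subset_iff[OF that, of s2 t2]
      t_down_le_iff[OF that(1), of s1 t1 t] t_down_le_iff[OF that(1), of s2 t2 t] assms(3)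
    by (auto simp: \<tau>2_def)
  have \<tau>2_less: "\<tau>2 s < 1" if "0 < s" "s \<le> s1" for s
    using that t_down_less_1[of s s1 t1] t_down_less_1[of s s2 t2] t1 t2 assms(3) by (auto simp: \<tau>2_def)
  have \<tau>2_s1: "0 \<le> \<tau>2 s1" using t_down_self[OF s1] t1 by (simp add: \<tau>2_def)
  \<comment> \<open>The dual statement. A point of the graph of \<open>\<tau>2\<close> has one of \<open>P1\<close>, \<open>P2\<close> on its forward curve, and a detour
    through a later point would lead strictly below it. Only a detour through \<open>s' = s1\<close> may still reach \<open>P1\<close>, but
    then it cannot reach \<open>P2\<close>, which lies above the curve of \<open>P1\<close>.\<close>
  have \<tau>2_strict: "\<not> \<tau>2 s' \<le> t_up (s, \<tau>2 s) s'" if s: "0 < s" "s < s'" "s' \<le> s1" for s s'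
  proof
    assume le: "\<tau>2 s' \<le> t_up (s, \<tau>2 s) s'"
    have less1: "\<tau>2 s < 1" using \<tau>2_less that by simp
    have reach1: "t1 \<le> t_up (s', t_up (s, \<tau>2 s) s') s1"
      using le t_down_le_iff[of s' s1 t1] s by (simp add: \<tau>2_def)
    have reach2: "t2 \<le> t_up (s', t_up (s, \<tau>2 s) s') s2"
      using le t_down_le_iff[of s' s2 t2] s assms(3) by (simp add: \<tau>2_def)
    have "\<tau>2 s \<noteq> t_down (s2, t2) s"
      using reach2 t_up_two_steps_less[OF s(1,2) _ less1, of s2] t_up_t_down[of s s2 t2] s assms(3) by auto
    then have eq: "\<tau>2 s = t_down (s1, t1) s" by (auto simp: \<tau>2_def max_def split: if_splits)
    then have eq1: "t_up (s, \<tau>2 s) s1 = t1" using t_up_t_down[of s s1 t1] s by simp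
    show False
    proof (cases "s' = s1")
      case True
      then show False using reach2 eq1 assms(4) by simp
    next
      case False
      then show False using reach1 t_up_two_steps_less[OF s(1,2) _ less1, of s1] eq1 s by simp
    qed
  qed

  have inf: "qinf ?A1 ?A2 = {frakA s (\<tau>2 s) | s. 0 < s \<and> s \<le> s1 \<and> 0 \<le> \<tau>2 s}"
  proof (intro equalityI subsetI)
    fix A assume A: "A \<in> qinf ?A1 ?A2"
    then obtain s t where st: "A = frakA s t" "0 \<le> s" "0 \<le> t" "t \<le> 1"
      by (auto simp: qinf_def frakA_family_def)
    have max: "\<not> A \<subset> frakA s' t'" if "0 < s'" "s' \<le> s1" "0 \<le> t'" "\<tau>2 s' \<le> t'" "t' < 1" for s' t'
    proof -
      have "frakA s' t' \<in> frakA_family" unfolding frakA_family_def using that by force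
      moreover have "frakA s' t' \<subseteq> ?A1 \<inter> ?A2" using low_iff that by simp
      ultimately show ?thesis using A unfolding qinf_def by blast
    qed
    \<comment> \<open>A degenerate class is properly contained in the lower bound \<open>frakA s1 (\<tau>2 s1)\<close>.\<close>
    have nontriv: "0 < s \<and> t < 1"
    proof (rule ccontr)
      assume "\<not> ?thesis"
      then have triv: "s = 0 \<or> (0 < s \<and> t = 1)" using st by auto
      have "A \<subseteq> frakA s1 (\<tau>2 s1)"
        unfolding st(1) using frakA_trivial_subset[OF triv, of s1 "\<tau>2 s1"] s1 \<tau>2_less[OF s1] by simp
      moreover have "\<not> frakA s1 (\<tau>2 s1) \<subseteq> A"
      proof
        assume "frakA s1 (\<tau>2 s1) \<subseteq> A"
        then have "s1 \<le> s" "t \<le> t_up (s1, \<tau>2 s1) s"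
          using frakA_nontrivial_subset_iff[OF s1, of "\<tau>2 s1" s t] \<tau>2_less[OF s1] st(1) by auto
        then show False using triv s1 t_up_less_1[OF s1, of s "\<tau>2 s1"] \<tau>2_less[OF s1] by auto
      qed
      ultimately show False using max[of s1 "\<tau>2 s1"] s1 \<tau>2_s1 \<tau>2_less[OF s1] by auto
    qed
    then have s: "0 < s" and t: "t < 1" by auto
    have lb: "s \<le> s1" "\<tau>2 s \<le> t"
      using A low_iff[OF s t] st(1) by (auto simp: qinf_def)
    have eq: "t = max (\<tau>2 s) 0"
    proof (rule ccontr)
      assume "t \<noteq> max (\<tau>2 s) 0"
      then have lt: "max (\<tau>2 s) 0 < t" using lb st by auto
      let ?t = "max (\<tau>2 s) 0"
      have lt1: "?t < 1" using lt t by simp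
      have "A \<subseteq> frakA s ?t" "\<not> frakA s ?t \<subseteq> A"
        unfolding st(1) frakA_nontrivial_subset_iff[OF s t] frakA_nontrivial_subset_iff[OF s lt1]
        using lt t_up_self[OF s] by auto
      then show False using max[of s ?t] s lb lt1 by auto
    qed
    \<comment> \<open>If \<open>\<tau>2 s < 0\<close>, the curve issuing from \<open>(s, 0)\<close> passes strictly above \<open>P1\<close> and \<open>P2\<close>, so \<open>(s, 0)\<close> can be
      moved to the right along \<open>t = 0\<close>, which gives a larger lower bound.\<close>
    have "0 \<le> \<tau>2 s"
    proof (rule ccontr)
      assume neg: "\<not> 0 \<le> \<tau>2 s"
      then have t0: "t = 0" using eq by simp
      have "s < s1" using neg \<tau>2_s1 lb by (metis less_eq_real_def)
      have "t_down (s1, t1) s < 0" "t_down (s2, t2) s < 0" using neg by (auto simp: \<tau>2_def)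
      then have "t1 < t_up (s, 0) s1" "t2 < t_up (s, 0) s2"
        using t_up_less_mono[OF s, of s1 "t_down (s1, t1) s" 0] t_up_t_down[OF s, of s1 t1]
          t_up_less_mono[OF s, of s2 "t_down (s2, t2) s" 0] t_up_t_down[OF s, of s2 t2] \<open>s < s1\<close> assms(3)
        by auto
      then have "eventually (\<lambda>x. t1 < t_up (x, 0) s1) (at_right s)"
        "eventually (\<lambda>x. t2 < t_up (x, 0) s2) (at_right s)"
        using t_up_right_lower s \<open>s < s1\<close> assms(3) by auto
      moreover have "eventually (\<lambda>x. x \<in> {s<..<s1}) (at_right s)"
        by (rule eventually_at_right_real[OF \<open>s < s1\<close>])
      ultimately have "eventually (\<lambda>x. t1 < t_up (x, 0) s1 \<and> t2 < t_up (x, 0) s2 \<and> x \<in> {s<..<s1}) (at_right s)"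
        by eventually_elim auto
      then obtain x where x: "t1 < t_up (x, 0) s1" "t2 < t_up (x, 0) s2" "s < x" "x < s1"
        using eventually_happens'[OF trivial_limit_at_right_real] by (auto simp: greaterThanLessThan_iff)
      have "\<tau>2 x \<le> 0"
        using t_down_le_iff[of x s1 t1 0] t_down_le_iff[of x s2 t2 0] x s assms(3) by (simp add: \<tau>2_def)
      moreover have "A \<subseteq> frakA x 0" "\<not> frakA x 0 \<subseteq> A"
        unfolding st(1) t0 using x s t_up_ge[OF s, of x 0]
        by (simp_all add: frakA_nontrivial_subset_iff)
      ultimately show False using max[of x 0] x s by auto
    qed
    then show "A \<in> {frakA s (\<tau>2 s) | s. 0 < s \<and> s \<le> s1 \<and> 0 \<le> \<tau>2 s}"
      using st eq s lb by auto
  next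
    fix A assume "A \<in> {frakA s (\<tau>2 s) | s. 0 < s \<and> s \<le> s1 \<and> 0 \<le> \<tau>2 s}"
    then obtain s where A: "A = frakA s (\<tau>2 s)" and s: "0 < s" "s \<le> s1" "0 \<le> \<tau>2 s" by blast
    have less1: "\<tau>2 s < 1" using \<tau>2_less s by simp
    have fam: "A \<in> frakA_family" unfolding frakA_family_def A using s less1 by force
    have "\<not> A \<subset> A'" if A': "A' \<in> frakA_family" "A' \<subseteq> ?A1 \<inter> ?A2" for A'
    proof
      assume sub: "A \<subset> A'"
      obtain s' t' where st': "A' = frakA s' t'" "t' \<le> 1" using A'(1) by (auto simp: frakA_family_def)
      have le: "s \<le> s'" "t' \<le> t_up (s, \<tau>2 s) s'"
        using sub frakA_nontrivial_subset_iff[OF s(1) less1, of s' t'] st' A by auto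
      have s': "0 < s'" using s le by simp
      have t': "t' < 1" using le t_up_less_1[OF s(1) le(1) less1] by simp
      have lb: "s' \<le> s1" "\<tau>2 s' \<le> t'" using A'(2) low_iff[OF s' t'] st' by auto
      have "s' = s" using \<tau>2_strict[OF s(1), of s'] le lb by fastforce
      then have "t' = \<tau>2 s" using le lb t_up_self[OF s'] by simp
      with \<open>s' = s\<close> sub st' A show False by simp
    qed
    then show "A \<in> qinf ?A1 ?A2"
      using fam low_iff[OF s(1) less1] s A unfolding qinf_def by blast
  qed

  show ?thesis using sup inf unfolding \<tau>1_def \<tau>2_def by simp
qed

end
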